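(* Let $S$ be a finite Boolean inverse monoid. Then $S$ is isomorphic to the Boolean inverse monoid $\mathsf{K}(\mathsf{A}(S))$ of all local bisections of the groupoid $\mathsf{A}(S)$ of atoms of $S$.
   Context: For an inverse semigroup $S$, $\mathsf{E}(S)$ is its set of idempotents, $\mathbf{d}(a)=a^{-1}a$ and $\mathbf{r}(a)=aa^{-1}$. The natural partial order is $a\le b$ iff $a=ba^{-1}a$; joins and meets refer to it. Elements $a,b$ are compatible, $a\sim b$, if $a^{-1}b$ and $ab^{-1}$ are both idempotents. A Boolean algebra here means a generalized Boolean algebra: a distributive lattice with bottom (a top is not required) in which every principal order-ideal $x^{\downarrow}=\{y: y\le x\}$ is a (unital) Boolean algebra. An inverse semigroup with zero is distributive if any two compatible elements have a join and multiplication distributes on both sides over such joins; it is Boolean if in addition $(\mathsf{E}(S),\le)$ is a Boolean algebra. A Boolean inverse monoid is a Boolean inverse semigroup with identity. Boolean inverse semigroups are assumed not to be the zero semigroup $\{0\}$. An atom of $S$ is a non-zero element $a$ such that $x\le a$ implies $x=a$ or $x=0$. The restricted product $a\cdot b$ is defined exactly when $\mathbf{d}(a)=\mathbf{r}(b)$, and then equals $ab$. The set $\mathsf{A}(S)$ of atoms of $S$ is a groupoid under the restricted product. A groupoid is a small category in which every element (arrow) is invertible, regarded as a set of arrows with objects identified with identities; $\mathbf{d}(x)=x^{-1}x$, $\mathbf{r}(x)=xx^{-1}$. A subset $A$ of a groupoid $G$ is a local bisection if for $a,b\in A$, $\mathbf{d}(a)=\mathbf{d}(b)$ implies $a=b$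 and $\mathbf{r}(a)=\mathbf{r}(b)$ implies $a=b$ (the empty set is a local bisection). $\mathsf{K}(G)$ is the set of all local bisections of $G$ with multiplication $AB=\{ab: a\in A, b\in B, \mathbf{d}(a)=\mathbf{r}(b)\}$. *)

theory Defs
  imports "HOL-Algebra.Group" "HOL-Algebra.Lattice"
begin

section \<open>Boolean algebras\<close>

locale distributive_lattice = lattice L for L (structure) +
  assumes meet_join_distrib:
    "\<lbrakk>x \<in> carrier L; y \<in> carrier L; z \<in> carrier L\<rbrakk>
      \<Longrightarrow> x \<sqinter> (y \<squnion> z) = (x \<sqinter> y) \<squnion> (x \<sqinter> z)"

locale unital_boolean_algebra =
  distributive_lattice L + bounded_lattice L for L (structure) +
  assumes complement_exists:
    "x \<in> carrier L \<Longrightarrow> \<exists>y \<in> carrier L. x \<sqinter> y = \<bottom> \<and> x \<squnion> y = \<top>"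

definition principal_ideal :: "('a, 'b) gorder_scheme \<Rightarrow> 'a \<Rightarrow> ('a, 'b) gorder_scheme"
  where "principal_ideal L x = L\<lparr>carrier := {y \<in> carrier L. y \<sqsubseteq>\<^bsub>L\<^esub> x}\<rparr>"

locale generalized_boolean_algebra =
  distributive_lattice L + weak_partial_order_bottom L for L (structure) +
  assumes principal_ideal_boolean:
    "x \<in> carrier L \<Longrightarrow> unital_boolean_algebra (principal_ideal L x)"


section \<open>Inverse semigroups\<close>

text \<open>Semigroups are represented by the monoid record as well; only \<^locale>\<open>monoid\<close> constrains
  the field \<open>one\<close>.\<close>

definition is_sg_inverse :: "('a, 'b) monoid_scheme \<Rightarrow> 'a \<Rightarrow> 'a \<Rightarrow> bool"
  where "is_sg_inverse S a b \<longleftrightarrow>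
    b \<in> carrier S \<and> a \<otimes>\<^bsub>S\<^esub> b \<otimes>\<^bsub>S\<^esub> a = a \<and> b \<otimes>\<^bsub>S\<^esub> a \<otimes>\<^bsub>S\<^esub> b = b"

locale inverse_semigroup =
  fixes S :: "('a, 'b) monoid_scheme" (structure)
  assumes sg_closed: "\<lbrakk>a \<in> carrier S; b \<in> carrier S\<rbrakk> \<Longrightarrow> a \<otimes> b \<in> carrier S"
    and sg_assoc: "\<lbrakk>a \<in> carrier S; b \<in> carrier S; c \<in> carrier S\<rbrakk>
      \<Longrightarrow> (a \<otimes> b) \<otimes> c = a \<otimes> (b \<otimes> c)"
    and sg_inverse_ex1: "a \<in> carrier S \<Longrightarrow> \<exists>!b. is_sg_inverse S a b"

text \<open>Not to be confused with \<^const>\<open>m_inv\<close>, the group-theoretic inverse.\<close>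

definition sg_inv :: "('a, 'b) monoid_scheme \<Rightarrow> 'a \<Rightarrow> 'a"
  where "sg_inv S a = (THE b. is_sg_inverse S a b)"

definition sg_dom :: "('a, 'b) monoid_scheme \<Rightarrow> 'a \<Rightarrow> 'a"
  where "sg_dom S a = sg_inv S a \<otimes>\<^bsub>S\<^esub> a"

definition sg_ran :: "('a, 'b) monoid_scheme \<Rightarrow> 'a \<Rightarrow> 'a"
  where "sg_ran S a = a \<otimes>\<^bsub>S\<^esub> sg_inv S a"

definition idempotents :: "('a, 'b) monoid_scheme \<Rightarrow> 'a set"
  where "idempotents S = {e \<in> carrier S. e \<otimes>\<^bsub>S\<^esub> e = e}"

definition natural_order :: "('a, 'b) monoid_scheme \<Rightarrow> 'a gorder"
  where "natural_order S =
    \<lparr>carrier = carrier S, eq = (=), le = (\<lambda>a b. a = b \<otimes>\<^bsub>S\<^esub> sg_inv S a \<otimes>\<^bsub>S\<^esub> a)\<rparr>"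

definition idempotent_order :: "('a, 'b) monoid_scheme \<Rightarrow> 'a gorder"
  where "idempotent_order S = (natural_order S)\<lparr>carrier := idempotents S\<rparr>"

definition is_sg_join :: "('a, 'b) monoid_scheme \<Rightarrow> 'a \<Rightarrow> 'a \<Rightarrow> 'a \<Rightarrow> bool"
  where "is_sg_join S a b j \<longleftrightarrow> least (natural_order S) j (Upper (natural_order S) {a, b})"

definition compatible :: "('a, 'b) monoid_scheme \<Rightarrow> 'a \<Rightarrow> 'a \<Rightarrow> bool"
  where "compatible S a b \<longleftrightarrow>
    sg_inv S a \<otimes>\<^bsub>S\<^esub> b \<in> idempotents S \<and> a \<otimes>\<^bsub>S\<^esub> sg_inv S b \<in> idempotents S"

definition is_sg_zero :: "('a, 'b) monoid_scheme \<Rightarrow> 'a \<Rightarrow> bool"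
  where "is_sg_zero S z \<longleftrightarrow>
    z \<in> carrier S \<and> (\<forall>a \<in> carrier S. z \<otimes>\<^bsub>S\<^esub> a = z \<and> a \<otimes>\<^bsub>S\<^esub> z = z)"

definition sg_zero :: "('a, 'b) monoid_scheme \<Rightarrow> 'a"
  where "sg_zero S = (THE z. is_sg_zero S z)"

locale distributive_inverse_semigroup = inverse_semigroup +
  assumes zero_exists: "\<exists>z. is_sg_zero S z"
    and compatible_join_exists:
      "\<lbrakk>a \<in> carrier S; b \<in> carrier S; compatible S a b\<rbrakk> \<Longrightarrow> \<exists>j. is_sg_join S a b j"
    and mult_join_left:
      "\<lbrakk>a \<in> carrier S; b \<in> carrier S; c \<in> carrier S; compatible S a b; is_sg_join S a b j\<rbrakk>
        \<Longrightarrow> is_sg_join S (c \<otimes> a) (c \<otimes> b) (c \<otimes> j)"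
    and mult_join_right:
      "\<lbrakk>a \<in> carrier S; b \<in> carrier S; c \<in> carrier S; compatible S a b; is_sg_join S a b j\<rbrakk>
        \<Longrightarrow> is_sg_join S (a \<otimes> c) (b \<otimes> c) (j \<otimes> c)"

locale boolean_inverse_semigroup = distributive_inverse_semigroup +
  assumes idempotents_boolean: "generalized_boolean_algebra (idempotent_order S)"
    and not_zero_semigroup: "carrier S \<noteq> {sg_zero S}"

locale boolean_inverse_monoid = boolean_inverse_semigroup S + monoid S for S (structure)


section \<open>Groupoids and local bisections\<close>

text \<open>A small category is given by its set of arrows and its partial composition alone
  (\<open>None\<close> means undefined). Objects are identified with identity arrows: the elements that
  act neutrally whenever a composite with them is defined.\<close>

record 'a arrow_structure = "'a partial_object" +
  pcomp :: "'a \<Rightarrow> 'a \<Rightarrow> 'a option"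

definition identity_arrow :: "('a, 'b) arrow_structure_scheme \<Rightarrow> 'a \<Rightarrow> bool"
  where "identity_arrow G e \<longleftrightarrow> e \<in> carrier G \<and>
    (\<forall>x \<in> carrier G. \<forall>y. (pcomp G e x = Some y \<longrightarrow> y = x) \<and> (pcomp G x e = Some y \<longrightarrow> y = x))"

locale arrow_category =
  fixes G :: "('a, 'b) arrow_structure_scheme"
  assumes comp_closed:
      "pcomp G x y = Some z \<Longrightarrow> x \<in> carrier G \<and> y \<in> carrier G \<and> z \<in> carrier G"
    and comp_assoc: \<comment> \<open>one side is defined iff the other is, and then they agree\<close>
      "\<lbrakk>x \<in> carrier G; y \<in> carrier G; z \<in> carrier G\<rbrakk> \<Longrightarrow>
        Option.bind (pcomp G x y) (\<lambda>u. pcomp G u z) = Option.bind (pcomp G y z) (\<lambda>v. pcomp G x v)"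
    and comp_defined:
      "\<lbrakk>pcomp G x y = Some u; pcomp G y z = Some v\<rbrakk> \<Longrightarrow> pcomp G u z \<noteq> None"
    and right_identity_exists:
      "x \<in> carrier G \<Longrightarrow> \<exists>e. identity_arrow G e \<and> pcomp G x e \<noteq> None"
    and left_identity_exists:
      "x \<in> carrier G \<Longrightarrow> \<exists>f. identity_arrow G f \<and> pcomp G f x \<noteq> None"

definition is_arrow_inverse :: "('a, 'b) arrow_structure_scheme \<Rightarrow> 'a \<Rightarrow> 'a \<Rightarrow> bool"
  where "is_arrow_inverse G x y \<longleftrightarrow> y \<in> carrier G \<and>
    (\<exists>e. identity_arrow G e \<and> pcomp G y x = Some e) \<and>
    (\<exists>f. identity_arrow G f \<and> pcomp G x y = Some f)"

locale groupoid = arrow_category +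
  assumes arrow_inverse_exists: "x \<in> carrier G \<Longrightarrow> \<exists>y. is_arrow_inverse G x y"

definition arrow_inv :: "('a, 'b) arrow_structure_scheme \<Rightarrow> 'a \<Rightarrow> 'a"
  where "arrow_inv G x = (THE y. is_arrow_inverse G x y)"

definition arrow_dom :: "('a, 'b) arrow_structure_scheme \<Rightarrow> 'a \<Rightarrow> 'a"
  where "arrow_dom G x = the (pcomp G (arrow_inv G x) x)"

definition arrow_ran :: "('a, 'b) arrow_structure_scheme \<Rightarrow> 'a \<Rightarrow> 'a"
  where "arrow_ran G x = the (pcomp G x (arrow_inv G x))"

definition local_bisection :: "('a, 'b) arrow_structure_scheme \<Rightarrow> 'a set \<Rightarrow> bool"
  where "local_bisection G A \<longleftrightarrow> A \<subseteq> carrier G \<and>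
    (\<forall>a \<in> A. \<forall>b \<in> A. (arrow_dom G a = arrow_dom G b \<longrightarrow> a = b) \<and>
                     (arrow_ran G a = arrow_ran G b \<longrightarrow> a = b))"

definition local_bisection_monoid :: "('a, 'b) arrow_structure_scheme \<Rightarrow> 'a set monoid"  (\<open>\<K>\<close>)
  where "\<K> G =
    \<lparr>carrier = {A. local_bisection G A},
     mult = (\<lambda>A B. {the (pcomp G a b) | a b. a \<in> A \<and> b \<in> B \<and> arrow_dom G a = arrow_ran G b}),
     one = {e. identity_arrow G e}\<rparr>"


section \<open>The groupoid of atoms\<close>

definition atoms :: "('a, 'b) monoid_scheme \<Rightarrow> 'a set"
  where "atoms S = {a \<in> carrier S. a \<noteq> sg_zero S \<and>
    (\<forall>x \<in> carrier S. x \<sqsubseteq>\<^bsub>natural_order S\<^esub> a \<longrightarrow> x = a \<or> x = sg_zero S)}"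

definition atom_groupoid :: "('a, 'b) monoid_scheme \<Rightarrow> 'a arrow_structure"  (\<open>\<A>\<close>)
  where "\<A> S =
    \<lparr>carrier = atoms S,
     pcomp = (\<lambda>a b. if a \<in> atoms S \<and> b \<in> atoms S \<and> sg_dom S a = sg_ran S b
                    then Some (a \<otimes>\<^bsub>S\<^esub> b) else None)\<rparr>"

end

theory Submission
  imports Defs
begin

text \<open>
  The isomorphism sends \<open>a\<close> to the set \<open>atoms_below a\<close> of atoms below it.  It rests on the
  correspondence between the elements below \<open>a\<close> and the idempotents below the domain \<open>a\<^sup>\<star>a\<close>, given by
  \<open>x \<mapsto> x\<^sup>\<star>x\<close> and \<open>e \<mapsto> ae\<close>.  It shows that \<open>a\<close> is an atom exactly when \<open>a\<^sup>\<star>a\<close> is one, so that the atoms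
  form a groupoid under restricted products (\<open>atoms_groupoid\<close>), and that distinct atoms below \<open>a\<close>
  have distinct domains and ranges, so that \<open>atoms_below a\<close> is a local bisection.

  The map is multiplicative (\<open>atoms_below_mult\<close>) because every atom \<open>z \<le> ab\<close> is a restricted product
  of an atom below \<open>a\<close> and an atom below \<open>b\<close>, obtained by cutting \<open>b\<close> down to the domain of \<open>z\<close>
  and then \<open>a\<close> down to the range of the result.

  It reflects the order, and so is injective (\<open>below_if_atoms_below_subset\<close>): complements in the Boolean
  algebra of idempotents allow an atom \<open>x \<le> a\<close> to be split off, writing \<open>a\<close> as the join of \<open>x\<close>
  and an element with fewer atoms below it.  Finiteness makes this process end.

  It is surjective (\<open>exists_join_of_bisection\<close>): the atoms in a local bisection have pairwise orthogonal
  domains and ranges, so they are compatible and can be joined one after another, and a join of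
  compatible elements has no atoms below it except those below the parts (\<open>atoms_below_join\<close>).

  That the target is a Boolean inverse monoid has nothing to do with atoms: it holds for the local
  bisections of every nonempty groupoid (\<open>bisections_boolean_inverse_monoid\<close>), where the natural order
  is inclusion and the idempotents are the sets of identities.
\<close>

section \<open>Inverse semigroups\<close>

context inverse_semigroup
begin

abbreviation inverse_of :: "'a \<Rightarrow> 'a"  (\<open>_\<^sup>\<star>\<close> [1000] 1000)
  where "a\<^sup>\<star> \<equiv> sg_inv S a"

abbreviation below :: "'a \<Rightarrow> 'a \<Rightarrow> bool"  (infix \<open>\<preceq>\<close> 50)
  where "a \<preceq> b \<equiv> a \<sqsubseteq>\<^bsub>natural_order S\<^esub> b"

abbreviation E :: "'a set"
  where "E \<equiv> idempotents S"

lemma is_inverse: "a \<in> carrier S \<Longrightarrow> is_sg_inverse S a (a\<^sup>\<star>)"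
  unfolding sg_inv_def by (rule theI') (rule sg_inverse_ex1)

lemma is_inverse_unique: "a \<in> carrier S \<Longrightarrow> is_sg_inverse S a b \<Longrightarrow> b = a\<^sup>\<star>"
  using sg_inverse_ex1 is_inverse by blast

lemma inverse_closed [simp]: "a \<in> carrier S \<Longrightarrow> a\<^sup>\<star> \<in> carrier S"
  using is_inverse by (simp add: is_sg_inverse_def)

declare sg_closed [simp]

lemma mult_inverse_mult:
  assumes "a \<in> carrier S"
  shows "a \<otimes> (a\<^sup>\<star> \<otimes> a) = a" "a\<^sup>\<star> \<otimes> (a \<otimes> a\<^sup>\<star>) = a\<^sup>\<star>"
  using is_inverse[OF assms] assms by (simp_all add: is_sg_inverse_def sg_assoc)

lemma mult_inverse_mult_left:
  assumes "a \<in> carrier S" "c \<in> carrier S"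
  shows "a \<otimes> (a\<^sup>\<star> \<otimes> (a \<otimes> c)) = a \<otimes> c" "a\<^sup>\<star> \<otimes> (a \<otimes> (a\<^sup>\<star> \<otimes> c)) = a\<^sup>\<star> \<otimes> c"
  using mult_inverse_mult[OF assms(1)] assms
  by (metis inverse_closed sg_assoc sg_closed)+

lemmas inverse_cancel = mult_inverse_mult mult_inverse_mult_left

lemma inverse_inverse [simp]:
  assumes "a \<in> carrier S"
  shows "a\<^sup>\<star>\<^sup>\<star> = a"
  using is_inverse_unique[of "a\<^sup>\<star>" a] assms
  by (simp add: is_sg_inverse_def sg_assoc inverse_cancel)

lemma idempotentI: "e \<in> carrier S \<Longrightarrow> e \<otimes> e = e \<Longrightarrow> e \<in> E"
  unfolding idempotents_def by blast

lemma idempotent_mult [simp]: "e \<in> E \<Longrightarrow> e \<otimes> e = e"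
  unfolding idempotents_def by blast

lemma idempotent_closed [simp]: "e \<in> E \<Longrightarrow> e \<in> carrier S"
  unfolding idempotents_def by blast

lemma idempotent_mult_left [simp]: "e \<in> E \<Longrightarrow> c \<in> carrier S \<Longrightarrow> e \<otimes> (e \<otimes> c) = e \<otimes> c"
  by (metis idempotent_closed idempotent_mult sg_assoc)

lemma idempotent_inverse [simp]: "e \<in> E \<Longrightarrow> e\<^sup>\<star> = e"
  by (rule sym, rule is_inverse_unique) (simp_all add: is_sg_inverse_def)

lemma dom_idempotent [simp]: "a \<in> carrier S \<Longrightarrow> a\<^sup>\<star> \<otimes> a \<in> E"
  by (rule idempotentI) (simp_all add: sg_assoc inverse_cancel)

lemma ran_idempotent [simp]: "a \<in> carrier S \<Longrightarrow> a \<otimes> a\<^sup>\<star> \<in> E"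
  by (rule idempotentI) (simp_all add: sg_assoc inverse_cancel)

text \<open>With \<open>x = (ef)\<^sup>\<star>\<close>, the element \<open>fxe\<close> is another inverse of \<open>ef\<close>; uniqueness makes \<open>x = fxe\<close>
  idempotent, hence self-inverse, hence equal to \<open>ef\<close>.\<close>

lemma idempotent_product:
  assumes "e \<in> E" "f \<in> E"
  shows "e \<otimes> f \<in> E"
proof -
  define x where "x = (e \<otimes> f)\<^sup>\<star>"
  have C: "e \<in> carrier S" "f \<in> carrier S" "x \<in> carrier S"
    using assms by (auto simp: x_def)
  have x: "e \<otimes> (f \<otimes> (x \<otimes> (e \<otimes> f))) = e \<otimes> f" "x \<otimes> (e \<otimes> (f \<otimes> x)) = x"
    using mult_inverse_mult[of "e \<otimes> f"] C by (simp_all add: x_def sg_assoc)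
  have xc: "x \<otimes> (e \<otimes> (f \<otimes> (x \<otimes> c))) = x \<otimes> c" if "c \<in> carrier S" for c
    using x(2) C that by (metis sg_assoc sg_closed)
  have "is_sg_inverse S (e \<otimes> f) (f \<otimes> (x \<otimes> e))"
    using assms C x xc by (simp add: is_sg_inverse_def sg_assoc)
  then have fxe: "f \<otimes> (x \<otimes> e) = x"
    unfolding x_def using is_inverse_unique[OF sg_closed[OF C(1,2)]] by blast
  have "(f \<otimes> (x \<otimes> e)) \<otimes> (f \<otimes> (x \<otimes> e)) = f \<otimes> (x \<otimes> e)"
    using C xc by (simp add: sg_assoc)
  then have "x \<in> E"
    unfolding fxe idempotents_def using C(3) by blast
  moreover have "x\<^sup>\<star> = e \<otimes> f"
    unfolding x_def by (rule inverse_inverse) (simp add: C)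
  ultimately show ?thesis
    using idempotent_inverse[of x] by (simp only:)
qed

text \<open>Both products being idempotent, \<open>fe\<close> is an inverse of \<open>ef\<close>, and so is \<open>ef\<close> itself.\<close>

lemma idempotent_commute:
  assumes "e \<in> E" "f \<in> E"
  shows "e \<otimes> f = f \<otimes> e"
proof -
  have "e \<otimes> f \<in> E" "f \<otimes> e \<in> E"
    using assms by (auto intro: idempotent_product)
  then have "e \<otimes> f \<otimes> (e \<otimes> f) = e \<otimes> f" "f \<otimes> e \<otimes> (f \<otimes> e) = f \<otimes> e"
    by auto
  then have "is_sg_inverse S (e \<otimes> f) (f \<otimes> e)"
    using assms by (simp add: is_sg_inverse_def sg_assoc)
  then show ?thesis
    using is_inverse_unique[of "e \<otimes> f" "f \<otimes> e"] assms \<open>e \<otimes> f \<in> E\<close> by simp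
qed

lemma idempotent_commute_left:
  "e \<in> E \<Longrightarrow> f \<in> E \<Longrightarrow> c \<in> carrier S \<Longrightarrow> e \<otimes> (f \<otimes> c) = f \<otimes> (e \<otimes> c)"
  by (metis idempotent_closed idempotent_commute sg_assoc)

text \<open>In \<open>ab(b\<^sup>\<star>a\<^sup>\<star>)ab\<close> and \<open>b\<^sup>\<star>a\<^sup>\<star>(ab)b\<^sup>\<star>a\<^sup>\<star>\<close>, commuting \<open>bb\<^sup>\<star>\<close> past \<open>a\<^sup>\<star>a\<close> lets every inverse
  cancel.\<close>

lemma inverse_mult:
  assumes "a \<in> carrier S" "b \<in> carrier S"
  shows "(a \<otimes> b)\<^sup>\<star> = b\<^sup>\<star> \<otimes> a\<^sup>\<star>"
proof -
  have comm: "b \<otimes> (b\<^sup>\<star> \<otimes> (a\<^sup>\<star> \<otimes> (a \<otimes> c))) = a\<^sup>\<star> \<otimes> (a \<otimes> (b \<otimes> (b\<^sup>\<star> \<otimes> c)))"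
    if "c \<in> carrier S" for c
    using idempotent_commute_left[of "b \<otimes> b\<^sup>\<star>" "a\<^sup>\<star> \<otimes> a" c] assms that by (simp add: sg_assoc)
  have "a \<otimes> (b \<otimes> (b\<^sup>\<star> \<otimes> (a\<^sup>\<star> \<otimes> (a \<otimes> b)))) = a \<otimes> b"
    unfolding comm[OF assms(2)] using assms by (simp add: inverse_cancel)
  moreover have "b\<^sup>\<star> \<otimes> (a\<^sup>\<star> \<otimes> (a \<otimes> (b \<otimes> (b\<^sup>\<star> \<otimes> a\<^sup>\<star>)))) = b\<^sup>\<star> \<otimes> a\<^sup>\<star>"
    unfolding comm[OF inverse_closed[OF assms(1)], symmetric] using assms
    by (simp add: inverse_cancel)
  ultimately have "is_sg_inverse S (a \<otimes> b) (b\<^sup>\<star> \<otimes> a\<^sup>\<star>)"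
    using assms by (simp add: is_sg_inverse_def sg_assoc)
  then show ?thesis
    using is_inverse_unique assms by simp
qed

section \<open>The natural partial order\<close>

lemma below_iff: "a \<preceq> b \<longleftrightarrow> a = b \<otimes> a\<^sup>\<star> \<otimes> a"
  by (simp add: natural_order_def)

text \<open>For \<open>a = be\<close> the domain is \<open>a\<^sup>\<star>a = e(b\<^sup>\<star>b)e\<close>, and commuting idempotents turn \<open>b(a\<^sup>\<star>a)\<close> back into
  \<open>be = a\<close>.\<close>

lemma below_iff_restriction:
  assumes "a \<in> carrier S" "b \<in> carrier S"
  shows "a \<preceq> b \<longleftrightarrow> (\<exists>e\<in>E. a = b \<otimes> e)"
proof
  assume "a \<preceq> b"
  then show "\<exists>e\<in>E. a = b \<otimes> e"
    using assms by (auto simp: below_iff sg_assoc intro!: bexI[of _ "a\<^sup>\<star> \<otimes> a"])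
next
  assume "\<exists>e\<in>E. a = b \<otimes> e"
  then obtain e where e: "e \<in> E" "a = b \<otimes> e" by blast
  have "b \<otimes> (a\<^sup>\<star> \<otimes> a) = b \<otimes> (e \<otimes> ((b\<^sup>\<star> \<otimes> b) \<otimes> e))"
    using assms e by (simp add: inverse_mult sg_assoc)
  also have "\<dots> = b \<otimes> ((b\<^sup>\<star> \<otimes> b) \<otimes> (e \<otimes> e))"
    using assms e by (subst idempotent_commute_left) simp_all
  also have "\<dots> = a"
    using assms e by (simp add: sg_assoc inverse_cancel)
  finally show "a \<preceq> b"
    using assms by (simp add: below_iff sg_assoc)
qed

text \<open>Restrictions \<open>be\<close> and corestrictions \<open>eb\<close> are interchangeable: \<open>be = (beb\<^sup>\<star>)b\<close> and
  \<open>eb = b(b\<^sup>\<star>eb)\<close>.  Having both forms makes multiplication monotone on either side.\<close>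

lemma below_iff_corestriction:
  assumes "a \<in> carrier S" "b \<in> carrier S"
  shows "a \<preceq> b \<longleftrightarrow> (\<exists>e\<in>E. a = e \<otimes> b)"
proof
  assume "a \<preceq> b"
  then obtain e where e: "e \<in> E" "a = b \<otimes> e"
    using assms by (auto simp: below_iff_restriction)
  have comm: "b\<^sup>\<star> \<otimes> (b \<otimes> (e \<otimes> c)) = e \<otimes> (b\<^sup>\<star> \<otimes> (b \<otimes> c))" if "c \<in> carrier S" for c
    using idempotent_commute_left[of "b\<^sup>\<star> \<otimes> b" e c] assms that e by (simp add: sg_assoc)
  have "b \<otimes> (e \<otimes> b\<^sup>\<star>) \<in> E"
    using assms e comm[of "b\<^sup>\<star>"] by (intro idempotentI) (simp_all add: sg_assoc inverse_cancel)
  moreover have "b \<otimes> (e \<otimes> b\<^sup>\<star>) \<otimes> b = a"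
    using assms e idempotent_commute[of e "b\<^sup>\<star> \<otimes> b"] by (simp add: sg_assoc inverse_cancel)
  ultimately show "\<exists>e\<in>E. a = e \<otimes> b" by metis
next
  assume "\<exists>e\<in>E. a = e \<otimes> b"
  then obtain e where e: "e \<in> E" "a = e \<otimes> b" by blast
  have comm: "b \<otimes> (b\<^sup>\<star> \<otimes> (e \<otimes> c)) = e \<otimes> (b \<otimes> (b\<^sup>\<star> \<otimes> c))" if "c \<in> carrier S" for c
    using idempotent_commute_left[of "b \<otimes> b\<^sup>\<star>" e c] assms that e by (simp add: sg_assoc)
  have "b\<^sup>\<star> \<otimes> (e \<otimes> b) \<in> E"
    using assms e comm[of b] by (intro idempotentI) (simp_all add: sg_assoc inverse_cancel)
  moreover have "b \<otimes> (b\<^sup>\<star> \<otimes> (e \<otimes> b)) = a"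
    using assms e comm[of b] by (simp add: sg_assoc inverse_cancel)
  ultimately show "a \<preceq> b"
    using assms by (auto simp: below_iff_restriction)
qed

lemma restriction_below: "b \<in> carrier S \<Longrightarrow> e \<in> E \<Longrightarrow> b \<otimes> e \<preceq> b"
  by (subst below_iff_restriction) auto

lemma corestriction_below: "b \<in> carrier S \<Longrightarrow> e \<in> E \<Longrightarrow> e \<otimes> b \<preceq> b"
  by (subst below_iff_corestriction) auto

lemma below_refl [simp]: "a \<in> carrier S \<Longrightarrow> a \<preceq> a"
  by (simp add: below_iff sg_assoc inverse_cancel)

lemma below_restriction: "a \<in> carrier S \<Longrightarrow> b \<in> carrier S \<Longrightarrow> a \<preceq> b \<Longrightarrow> a = b \<otimes> (a\<^sup>\<star> \<otimes> a)"
  by (simp add: below_iff sg_assoc)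

lemma below_antisym:
  assumes "a \<in> carrier S" "b \<in> carrier S" "a \<preceq> b" "b \<preceq> a"
  shows "a = b"
proof -
  have "a = b \<otimes> (a\<^sup>\<star> \<otimes> a)" "b = a \<otimes> (b\<^sup>\<star> \<otimes> b)"
    using assms by (auto intro: below_restriction)
  moreover have "b \<otimes> (a\<^sup>\<star> \<otimes> a) = a \<otimes> ((b\<^sup>\<star> \<otimes> b) \<otimes> (a\<^sup>\<star> \<otimes> a))"
    using assms calculation(2) by (metis dom_idempotent idempotent_closed sg_assoc)
  moreover have "\<dots> = a \<otimes> ((a\<^sup>\<star> \<otimes> a) \<otimes> (b\<^sup>\<star> \<otimes> b))"
    using assms by (subst idempotent_commute) simp_all
  moreover have "\<dots> = a \<otimes> (b\<^sup>\<star> \<otimes> b)"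
    using assms by (simp add: sg_assoc inverse_cancel)
  ultimately show ?thesis by metis
qed

lemma below_trans:
  assumes "a \<in> carrier S" "b \<in> carrier S" "c \<in> carrier S" "a \<preceq> b" "b \<preceq> c"
  shows "a \<preceq> c"
proof -
  obtain e f where "e \<in> E" "f \<in> E" "a = b \<otimes> e" "b = c \<otimes> f"
    using assms by (auto simp: below_iff_restriction)
  then have "f \<otimes> e \<in> E" "a = c \<otimes> (f \<otimes> e)"
    using assms by (auto simp: sg_assoc intro: idempotent_product)
  then show ?thesis
    using assms below_iff_restriction by blast
qed

lemma mult_mono_right:
  assumes "a \<in> carrier S" "b \<in> carrier S" "c \<in> carrier S" "a \<preceq> b"
  shows "a \<otimes> c \<preceq> b \<otimes> c"
proof -
  obtain e where "e \<in> E" "a = e \<otimes> b"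
    using assms by (auto simp: below_iff_corestriction)
  then show ?thesis
    using assms corestriction_below[of "b \<otimes> c" e] by (simp add: sg_assoc)
qed

lemma mult_mono_left:
  assumes "a \<in> carrier S" "b \<in> carrier S" "c \<in> carrier S" "a \<preceq> b"
  shows "c \<otimes> a \<preceq> c \<otimes> b"
proof -
  obtain e where "e \<in> E" "a = b \<otimes> e"
    using assms by (auto simp: below_iff_restriction)
  then show ?thesis
    using assms restriction_below[of "c \<otimes> b" e] by (simp add: sg_assoc)
qed

lemma mult_mono:
  assumes "a \<in> carrier S" "b \<in> carrier S" "c \<in> carrier S" "d \<in> carrier S" "a \<preceq> b" "c \<preceq> d"
  shows "a \<otimes> c \<preceq> b \<otimes> d"
  using below_trans[of "a \<otimes> c" "b \<otimes> c" "b \<otimes> d"] mult_mono_right mult_mono_left assms by simp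

lemma inverse_mono:
  assumes "a \<in> carrier S" "b \<in> carrier S" "a \<preceq> b"
  shows "a\<^sup>\<star> \<preceq> b\<^sup>\<star>"
proof -
  obtain e where "e \<in> E" "a = b \<otimes> e"
    using assms by (auto simp: below_iff_restriction)
  then show ?thesis
    using assms by (simp add: inverse_mult corestriction_below)
qed

lemma dom_mono:
  "a \<in> carrier S \<Longrightarrow> b \<in> carrier S \<Longrightarrow> a \<preceq> b \<Longrightarrow> a\<^sup>\<star> \<otimes> a \<preceq> b\<^sup>\<star> \<otimes> b"
  by (simp add: mult_mono inverse_mono)

lemma idempotent_below_iff: "e \<in> E \<Longrightarrow> f \<in> E \<Longrightarrow> e \<preceq> f \<longleftrightarrow> e = f \<otimes> e"
  by (simp add: below_iff sg_assoc)

lemma below_idempotent: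
  assumes "a \<in> carrier S" "e \<in> E" "a \<preceq> e"
  shows "a \<in> E"
proof -
  obtain f where "f \<in> E" "a = e \<otimes> f"
    using assms by (auto simp: below_iff_restriction)
  then show ?thesis
    using assms idempotent_product by blast
qed

lemma dom_restriction:
  assumes "a \<in> carrier S" "e \<in> E" "e \<preceq> a\<^sup>\<star> \<otimes> a"
  shows "(a \<otimes> e)\<^sup>\<star> \<otimes> (a \<otimes> e) = e"
proof -
  have "a\<^sup>\<star> \<otimes> (a \<otimes> e) = e"
    using assms by (simp add: idempotent_below_iff sg_assoc)
  then show ?thesis
    using assms by (simp add: inverse_mult sg_assoc)
qed

text \<open>Below a common upper bound \<open>b\<close>, an element \<open>a = b (a\<^sup>\<star>a)\<close> is determined by its domain.\<close>

lemma below_eq_of_dom_eq: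
  assumes "a \<in> carrier S" "c \<in> carrier S" "b \<in> carrier S" "a \<preceq> b" "c \<preceq> b"
    "a\<^sup>\<star> \<otimes> a = c\<^sup>\<star> \<otimes> c"
  shows "a = c"
  using below_restriction[of a b] below_restriction[of c b] assms by metis

lemma is_join_iff:
  assumes "a \<in> carrier S" "b \<in> carrier S"
  shows "is_sg_join S a b j \<longleftrightarrow> j \<in> carrier S \<and> a \<preceq> j \<and> b \<preceq> j \<and>
    (\<forall>u\<in>carrier S. a \<preceq> u \<longrightarrow> b \<preceq> u \<longrightarrow> j \<preceq> u)"
  using assms unfolding is_sg_join_def least_def Upper_def by (auto simp: natural_order_def)

end

lemma is_zero_sg_zero:
  assumes "\<exists>z. is_sg_zero S z"
  shows "is_sg_zero S (sg_zero S)"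
  unfolding sg_zero_def
proof (rule theI')
  show "\<exists>!z. is_sg_zero S z"
    using assms unfolding is_sg_zero_def by metis
qed


section \<open>Groupoids\<close>

context groupoid
begin

abbreviation comp :: "'a \<Rightarrow> 'a \<Rightarrow> 'a"  (infixl \<open>\<bullet>\<close> 70)
  where "x \<bullet> y \<equiv> the (pcomp G x y)"

abbreviation D :: "'a \<Rightarrow> 'a"
  where "D \<equiv> arrow_dom G"

abbreviation R :: "'a \<Rightarrow> 'a"
  where "R \<equiv> arrow_ran G"

abbreviation arrow_inverse :: "'a \<Rightarrow> 'a"  (\<open>_\<^sup>-\<close> [1000] 1000)
  where "x\<^sup>- \<equiv> arrow_inv G x"

lemma identity_closed: "identity_arrow G e \<Longrightarrow> e \<in> carrier G"
  by (simp add: identity_arrow_def)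

lemma identity_left: "identity_arrow G e \<Longrightarrow> pcomp G e x \<noteq> None \<Longrightarrow> pcomp G e x = Some x"
  unfolding identity_arrow_def using comp_closed by fastforce

lemma identity_right: "identity_arrow G e \<Longrightarrow> pcomp G x e \<noteq> None \<Longrightarrow> pcomp G x e = Some x"
  unfolding identity_arrow_def using comp_closed by fastforce

text \<open>By associativity \<open>(xe)f = x(ef)\<close>, so \<open>ef\<close> is defined, and it equals both \<open>e\<close> and \<open>f\<close>.\<close>

lemma right_identity_unique:
  assumes "identity_arrow G e" "identity_arrow G f"
    "pcomp G x e \<noteq> None" "pcomp G x f \<noteq> None"
  shows "e = f"
proof -
  have "pcomp G x e = Some x" "pcomp G x f = Some x"
    using assms by (auto intro: identity_right)
  then have "Option.bind (pcomp G e f) (pcomp G x) = Some x"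
    using comp_assoc[of x e f] assms(1,2) identity_closed comp_closed by fastforce
  then have "pcomp G e f \<noteq> None" by (cases "pcomp G e f") auto
  then show ?thesis
    using identity_left[OF assms(1), of f] identity_right[OF assms(2), of e] by simp
qed

lemma left_identity_unique:
  assumes "identity_arrow G e" "identity_arrow G f"
    "pcomp G e x \<noteq> None" "pcomp G f x \<noteq> None"
  shows "e = f"
proof -
  have "pcomp G e x = Some x" "pcomp G f x = Some x"
    using assms by (auto intro: identity_left)
  then have "Option.bind (pcomp G e f) (\<lambda>u. pcomp G u x) = Some x"
    using comp_assoc[of e f x] assms(1,2) identity_closed comp_closed by fastforce
  then have "pcomp G e f \<noteq> None" by (cases "pcomp G e f") auto
  then show ?thesis
    using identity_left[OF assms(1), of f] identity_right[OF assms(2), of e] by simp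
qed

text \<open>If \<open>y\<close> and \<open>z\<close> are inverses of \<open>x\<close>, then \<open>(yx)z = y(xz)\<close> reads \<open>z = y\<close>.\<close>

lemma arrow_inverse_unique:
  assumes "is_arrow_inverse G x y" "is_arrow_inverse G x z"
  shows "y = z"
proof -
  obtain e where e: "identity_arrow G e" "pcomp G y x = Some e"
    using assms by (auto simp: is_arrow_inverse_def)
  obtain f where f: "identity_arrow G f" "pcomp G x z = Some f"
    using assms by (auto simp: is_arrow_inverse_def)
  have C: "x \<in> carrier G" "y \<in> carrier G" "z \<in> carrier G"
    using comp_closed e f by blast+
  have "pcomp G e z = Some z"
    using identity_left comp_defined e f by blast
  then have "pcomp G y f = Some z"
    using comp_assoc[of y x z] C e f by simp
  then show ?thesis
    using identity_right[OF f(1), of y] by simp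
qed

lemma is_arrow_inverse: "x \<in> carrier G \<Longrightarrow> is_arrow_inverse G x (x\<^sup>-)"
  unfolding arrow_inv_def by (rule theI') (use arrow_inverse_exists arrow_inverse_unique in blast)

lemma arrow_inverse_eq: "x \<in> carrier G \<Longrightarrow> is_arrow_inverse G x y \<Longrightarrow> x\<^sup>- = y"
  using is_arrow_inverse arrow_inverse_unique by blast

lemma arrow_inverse_closed [simp]: "x \<in> carrier G \<Longrightarrow> x\<^sup>- \<in> carrier G"
  using is_arrow_inverse by (simp add: is_arrow_inverse_def)

lemma inverse_pcomp:
  assumes "x \<in> carrier G"
  shows "pcomp G (x\<^sup>-) x = Some (D x)" "pcomp G x (x\<^sup>-) = Some (R x)"
    "identity_arrow G (D x)" "identity_arrow G (R x)"
  using is_arrow_inverse[OF assms]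
  by (auto simp: is_arrow_inverse_def arrow_dom_def arrow_ran_def)

lemma dom_closed [simp]: "x \<in> carrier G \<Longrightarrow> D x \<in> carrier G"
  by (rule identity_closed) (rule inverse_pcomp)

lemma ran_closed [simp]: "x \<in> carrier G \<Longrightarrow> R x \<in> carrier G"
  by (rule identity_closed) (rule inverse_pcomp)

lemma comp_ran:
  assumes "x \<in> carrier G"
  shows "pcomp G (R x) x = Some x"
  using identity_left comp_defined inverse_pcomp[OF assms] by blast

lemma comp_dom:
  assumes "x \<in> carrier G"
  shows "pcomp G x (D x) = Some x"
  using comp_assoc[of x "x\<^sup>-" x] assms comp_ran[OF assms] inverse_pcomp[OF assms] by simp

lemma dom_eqI: "x \<in> carrier G \<Longrightarrow> identity_arrow G e \<Longrightarrow> pcomp G x e \<noteq> None \<Longrightarrow> D x = e"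
  by (rule right_identity_unique[of _ _ x]) (simp_all add: inverse_pcomp comp_dom)

lemma ran_eqI: "x \<in> carrier G \<Longrightarrow> identity_arrow G e \<Longrightarrow> pcomp G e x \<noteq> None \<Longrightarrow> R x = e"
  by (rule left_identity_unique[of _ _ x]) (simp_all add: inverse_pcomp comp_ran)

text \<open>If \<open>xy = (x D(x))y\<close> is defined then so is \<open>D(x)y\<close>, which makes \<open>D(x)\<close> the left identity of \<open>y\<close>.
  Conversely \<open>x\<close> and \<open>y\<close> can be composed through a common identity.\<close>

lemma composable_iff:
  assumes "x \<in> carrier G" "y \<in> carrier G"
  shows "pcomp G x y \<noteq> None \<longleftrightarrow> D x = R y"
proof
  assume "pcomp G x y \<noteq> None"
  then have "Option.bind (pcomp G (D x) y) (pcomp G x) \<noteq> None"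
    using comp_assoc[of x "D x" y] assms comp_dom by simp
  then have "pcomp G (D x) y \<noteq> None" by (cases "pcomp G (D x) y") auto
  then show "D x = R y"
    using ran_eqI assms inverse_pcomp(3) by metis
next
  assume "D x = R y"
  then show "pcomp G x y \<noteq> None"
    using comp_defined[of x "D x" x y y] comp_dom[OF assms(1)] comp_ran[OF assms(2)] by simp
qed

lemma pcomp_eq:
  "x \<in> carrier G \<Longrightarrow> y \<in> carrier G \<Longrightarrow> D x = R y \<Longrightarrow> pcomp G x y = Some (x \<bullet> y)"
  using composable_iff by fastforce

lemma comp_in_carrier [simp]:
  "x \<in> carrier G \<Longrightarrow> y \<in> carrier G \<Longrightarrow> D x = R y \<Longrightarrow> x \<bullet> y \<in> carrier G"
  using pcomp_eq comp_closed by blast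

lemma dom_comp [simp]:
  assumes "x \<in> carrier G" "y \<in> carrier G" "D x = R y"
  shows "D (x \<bullet> y) = D y"
proof -
  obtain z where z: "pcomp G x y = Some z"
    using pcomp_eq[OF assms] by blast
  then have "pcomp G z (D y) = Some z"
    using comp_assoc[of x y "D y"] assms comp_dom[OF assms(2)] by simp
  then show ?thesis
    using dom_eqI[of z "D y"] comp_closed[OF z] inverse_pcomp(3)[OF assms(2)] z by simp
qed

lemma ran_comp [simp]:
  assumes "x \<in> carrier G" "y \<in> carrier G" "D x = R y"
  shows "R (x \<bullet> y) = R x"
proof -
  obtain z where z: "pcomp G x y = Some z"
    using pcomp_eq[OF assms] by blast
  then have "pcomp G (R x) z = Some z"
    using comp_assoc[of "R x" x y] assms comp_ran[OF assms(1)] by simp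
  then show ?thesis
    using ran_eqI[of z "R x"] comp_closed[OF z] inverse_pcomp(4)[OF assms(1)] z by simp
qed

lemma comp_assoc_total:
  assumes "x \<in> carrier G" "y \<in> carrier G" "z \<in> carrier G" "D x = R y" "D y = R z"
  shows "x \<bullet> y \<bullet> z = x \<bullet> (y \<bullet> z)"
proof -
  obtain u v where "pcomp G x y = Some u" "pcomp G y z = Some v"
    using pcomp_eq assms by blast
  then show ?thesis
    using comp_assoc[of x y z] assms by simp
qed

lemma dom_identity [simp]:
  assumes "identity_arrow G e"
  shows "D e = e"
  using identity_left[OF assms, of "D e"] comp_dom[OF identity_closed[OF assms]] by simp

lemma ran_identity [simp]:
  assumes "identity_arrow G e"
  shows "R e = e"
  using identity_right[OF assms, of "R e"] comp_ran[OF identity_closed[OF assms]] by simp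

lemma comp_dom_ran [simp]:
  assumes "x \<in> carrier G"
  shows "x \<bullet> D x = x" "R x \<bullet> x = x" "x\<^sup>- \<bullet> x = D x" "x \<bullet> x\<^sup>- = R x"
  using comp_dom[OF assms] comp_ran[OF assms] inverse_pcomp[OF assms] by simp_all

lemma identity_dom_ran [simp]:
  assumes "x \<in> carrier G"
  shows "identity_arrow G (D x)" "identity_arrow G (R x)"
  using assms inverse_pcomp by simp_all

lemma dom_ran_inverse [simp]:
  assumes "x \<in> carrier G"
  shows "D (x\<^sup>-) = R x" "R (x\<^sup>-) = D x"
proof -
  show "D (x\<^sup>-) = R x"
    using composable_iff[of "x\<^sup>-" x] inverse_pcomp[OF assms] assms by simp
  show "R (x\<^sup>-) = D x"
    using composable_iff[of x "x\<^sup>-"] inverse_pcomp[OF assms] assms by simp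
qed

lemma identity_iff_dom: "identity_arrow G e \<longleftrightarrow> e \<in> carrier G \<and> D e = e"
  using dom_identity identity_closed inverse_pcomp(3) by metis


section \<open>Local bisections\<close>

lemma bisection_closed: "local_bisection G A \<Longrightarrow> a \<in> A \<Longrightarrow> a \<in> carrier G"
  by (auto simp: local_bisection_def)

lemma bisection_dom_inj: "local_bisection G A \<Longrightarrow> a \<in> A \<Longrightarrow> b \<in> A \<Longrightarrow> D a = D b \<Longrightarrow> a = b"
  by (simp add: local_bisection_def)

lemma bisection_ran_inj: "local_bisection G A \<Longrightarrow> a \<in> A \<Longrightarrow> b \<in> A \<Longrightarrow> R a = R b \<Longrightarrow> a = b"
  by (simp add: local_bisection_def)

lemma bisectionI:
  assumes "A \<subseteq> carrier G"
    "\<And>a b. a \<in> A \<Longrightarrow> b \<in> A \<Longrightarrow> D a = D b \<Longrightarrow> a = b"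
    "\<And>a b. a \<in> A \<Longrightarrow> b \<in> A \<Longrightarrow> R a = R b \<Longrightarrow> a = b"
  shows "local_bisection G A"
  using assms by (simp add: local_bisection_def)

lemma bisection_carrier: "A \<in> carrier (\<K> G) \<longleftrightarrow> local_bisection G A"
  by (simp add: local_bisection_monoid_def)

lemma bisection_one: "\<one>\<^bsub>\<K> G\<^esub> = {e. identity_arrow G e}"
  by (simp add: local_bisection_monoid_def)

lemma bisection_mult: "A \<otimes>\<^bsub>\<K> G\<^esub> B = {a \<bullet> b | a b. a \<in> A \<and> b \<in> B \<and> D a = R b}"
  by (simp add: local_bisection_monoid_def)

lemma bisection_mult_closed:
  assumes A: "local_bisection G A" and B: "local_bisection G B"
  shows "local_bisection G (A \<otimes>\<^bsub>\<K> G\<^esub> B)"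
proof (rule bisectionI)
  show "A \<otimes>\<^bsub>\<K> G\<^esub> B \<subseteq> carrier G"
    using bisection_closed[OF A] bisection_closed[OF B] by (auto simp: bisection_mult)
next
  fix x y
  assume "x \<in> A \<otimes>\<^bsub>\<K> G\<^esub> B" "y \<in> A \<otimes>\<^bsub>\<K> G\<^esub> B"
  then obtain a b c d where x: "x = a \<bullet> b" "a \<in> A" "b \<in> B" "D a = R b"
    and y: "y = c \<bullet> d" "c \<in> A" "d \<in> B" "D c = R d"
    unfolding bisection_mult by blast
  have C: "a \<in> carrier G" "b \<in> carrier G" "c \<in> carrier G" "d \<in> carrier G"
    using x y bisection_closed[OF A] bisection_closed[OF B] by auto
  show "x = y" if "D x = D y"
  proof -
    have "b = d"
      by (rule bisection_dom_inj[OF B]) (use that x y C in simp_all)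
    have "a = c"
      by (rule bisection_dom_inj[OF A]) (use x y \<open>b = d\<close> in simp_all)
    then show ?thesis using \<open>b = d\<close> x y by simp
  qed
  show "x = y" if "R x = R y"
  proof -
    have "a = c"
      by (rule bisection_ran_inj[OF A]) (use that x y C in simp_all)
    have "b = d"
      by (rule bisection_ran_inj[OF B]) (use x y \<open>a = c\<close> in simp_all)
    then show ?thesis using \<open>a = c\<close> x y by simp
  qed
qed

lemma bisection_mult_assoc:
  assumes A: "A \<subseteq> carrier G" and B: "B \<subseteq> carrier G" and C: "C \<subseteq> carrier G"
  shows "A \<otimes>\<^bsub>\<K> G\<^esub> B \<otimes>\<^bsub>\<K> G\<^esub> C = A \<otimes>\<^bsub>\<K> G\<^esub> (B \<otimes>\<^bsub>\<K> G\<^esub> C)"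
proof (intro Set.set_eqI iffI)
  fix x
  assume "x \<in> A \<otimes>\<^bsub>\<K> G\<^esub> B \<otimes>\<^bsub>\<K> G\<^esub> C"
  then obtain a b c where x: "x = a \<bullet> b \<bullet> c" "a \<in> A" "b \<in> B" "c \<in> C" "D a = R b" "D (a \<bullet> b) = R c"
    unfolding bisection_mult by blast
  then have "a \<in> carrier G" "b \<in> carrier G" "c \<in> carrier G"
    using A B C by auto
  then have "x = a \<bullet> (b \<bullet> c)" "D b = R c" "D a = R (b \<bullet> c)"
    using x comp_assoc_total by simp_all
  then show "x \<in> A \<otimes>\<^bsub>\<K> G\<^esub> (B \<otimes>\<^bsub>\<K> G\<^esub> C)"
    unfolding bisection_mult using x(2-5) by blast
next
  fix x
  assume "x \<in> A \<otimes>\<^bsub>\<K> G\<^esub> (B \<otimes>\<^bsub>\<K> G\<^esub> C)"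
  then obtain a b c where x: "x = a \<bullet> (b \<bullet> c)" "a \<in> A" "b \<in> B" "c \<in> C" "D b = R c" "D a = R (b \<bullet> c)"
    unfolding bisection_mult by blast
  then have "a \<in> carrier G" "b \<in> carrier G" "c \<in> carrier G"
    using A B C by auto
  then have "x = a \<bullet> b \<bullet> c" "D a = R b" "D (a \<bullet> b) = R c"
    using x comp_assoc_total by simp_all
  then show "x \<in> A \<otimes>\<^bsub>\<K> G\<^esub> B \<otimes>\<^bsub>\<K> G\<^esub> C"
    unfolding bisection_mult using x(2-5) by blast
qed

lemma bisection_subset_carrier: "local_bisection G A \<Longrightarrow> A \<subseteq> carrier G"
  by (simp add: local_bisection_def)

lemma bisection_inverse_closed:
  assumes A: "local_bisection G A"
  shows "local_bisection G (arrow_inv G ` A)"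
proof (rule bisectionI)
  show "arrow_inv G ` A \<subseteq> carrier G"
    using bisection_closed[OF A] by auto
next
  fix x y
  assume "x \<in> arrow_inv G ` A" "y \<in> arrow_inv G ` A"
  then obtain a b where ab: "x = a\<^sup>-" "y = b\<^sup>-" "a \<in> A" "b \<in> A" by blast
  then have C: "a \<in> carrier G" "b \<in> carrier G"
    using bisection_closed[OF A] by auto
  show "x = y" if "D x = D y"
    using that ab C bisection_ran_inj[OF A, of a b] by simp
  show "x = y" if "R x = R y"
    using that ab C bisection_dom_inj[OF A, of a b] by simp
qed

text \<open>Within a bisection, \<open>a\<^sup>-b\<close> is only defined for \<open>a = b\<close>, since \<open>a\<close> and \<open>b\<close> must have the same range;
  similarly for \<open>ab\<^sup>-\<close>.\<close>

lemma bisection_inverse_mult: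
  assumes A: "local_bisection G A"
  shows "arrow_inv G ` A \<otimes>\<^bsub>\<K> G\<^esub> A = D ` A" "A \<otimes>\<^bsub>\<K> G\<^esub> arrow_inv G ` A = R ` A"
proof -
  have "a\<^sup>- \<bullet> b = D a" if "a \<in> A" "b \<in> A" "D (a\<^sup>-) = R b" for a b
    using that bisection_ran_inj[OF A, of a b] bisection_closed[OF A] by simp
  then show "arrow_inv G ` A \<otimes>\<^bsub>\<K> G\<^esub> A = D ` A"
    unfolding bisection_mult using bisection_closed[OF A] by (force simp: image_iff)
  have "a \<bullet> b\<^sup>- = R a" if "a \<in> A" "b \<in> A" "D a = R (b\<^sup>-)" for a b
    using that bisection_dom_inj[OF A, of a b] bisection_closed[OF A] by simp
  then show "A \<otimes>\<^bsub>\<K> G\<^esub> arrow_inv G ` A = R ` A"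
    unfolding bisection_mult using bisection_closed[OF A] by (force simp: image_iff)
qed

text \<open>An arrow composes only with the identities at its own domain and range, and they leave it
  unchanged.\<close>

lemma mult_identities:
  assumes A: "local_bisection G A"
    and I: "\<And>e. e \<in> I \<Longrightarrow> identity_arrow G e"
  shows "A \<otimes>\<^bsub>\<K> G\<^esub> I = {a \<in> A. D a \<in> I}" "I \<otimes>\<^bsub>\<K> G\<^esub> A = {a \<in> A. R a \<in> I}"
proof -
  have "a \<bullet> e = a" if "a \<in> A" "e \<in> I" "D a = R e" for a e
    using that bisection_closed[OF A] I comp_dom_ran(1)[of a] by simp
  moreover have "D a = R (D a) \<and> a = a \<bullet> D a" if "a \<in> A" for a
    using that bisection_closed[OF A] by simp
  ultimately show "A \<otimes>\<^bsub>\<K> G\<^esub> I = {a \<in> A. D a \<in> I}"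
    unfolding bisection_mult using I by fastforce
  have "e \<bullet> a = a" if "a \<in> A" "e \<in> I" "D e = R a" for a e
    using that bisection_closed[OF A] I comp_dom_ran(2)[of a] by simp
  moreover have "D (R a) = R a \<and> a = R a \<bullet> a" if "a \<in> A" for a
    using that bisection_closed[OF A] by simp
  ultimately show "I \<otimes>\<^bsub>\<K> G\<^esub> A = {a \<in> A. R a \<in> I}"
    unfolding bisection_mult using I by fastforce
qed

lemma identities_bisection: "(\<And>e. e \<in> I \<Longrightarrow> identity_arrow G e) \<Longrightarrow> local_bisection G I"
  by (rule bisectionI) (auto dest: identity_closed)

text \<open>If \<open>AA = A\<close> and \<open>a = bc\<close> with \<open>b, c \<in> A\<close>, then \<open>b\<close> has the range of \<open>a\<close> and \<open>c\<close> its domain, so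
  \<open>a = b = c\<close>; and \<open>a = aa\<close> forces \<open>a\<close> to be an identity.\<close>

lemma idempotent_bisections:
  "idempotents (\<K> G) = Pow {e. identity_arrow G e}"
proof (intro Set.set_eqI iffI)
  fix A
  assume "A \<in> idempotents (\<K> G)"
  then have A: "local_bisection G A" and idem: "A \<otimes>\<^bsub>\<K> G\<^esub> A = A"
    by (auto simp: idempotents_def bisection_carrier)
  have "identity_arrow G a" if "a \<in> A" for a
  proof -
    have "a \<in> A \<otimes>\<^bsub>\<K> G\<^esub> A"
      using that by (simp only: idem)
    then obtain b c where bc: "a = b \<bullet> c" "b \<in> A" "c \<in> A" "D b = R c"
      unfolding bisection_mult by blast
    have C: "b \<in> carrier G" "c \<in> carrier G"
      using bc bisection_closed[OF A] by auto
    have "R a = R b" "D a = D c"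
      unfolding bc(1) using C bc(4) by simp_all
    then have eq: "b = a" "c = a"
      using bisection_ran_inj[OF A that bc(2)] bisection_dom_inj[OF A that bc(3)] by blast+
    have a: "a \<bullet> a = a" "a \<in> carrier G" "D a = R a"
      using bc(1,4) C(1) unfolding eq by (simp_all only:)
    have "D a = a\<^sup>- \<bullet> (a \<bullet> a)"
      using a by simp
    also have "\<dots> = a\<^sup>- \<bullet> a \<bullet> a"
      using a by (intro comp_assoc_total[symmetric]) simp_all
    also have "\<dots> = a"
      using a comp_dom_ran(2)[of a] by simp
    finally show ?thesis
      using a by (simp add: identity_iff_dom)
  qed
  then show "A \<in> Pow {e. identity_arrow G e}" by auto
next
  fix A
  assume "A \<in> Pow {e. identity_arrow G e}"
  then have I: "\<And>e. e \<in> A \<Longrightarrow> identity_arrow G e" by auto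
  then have "A \<otimes>\<^bsub>\<K> G\<^esub> A = A"
    using mult_identities(1)[OF identities_bisection, of A A] by auto
  then show "A \<in> idempotents (\<K> G)"
    using I identities_bisection by (simp add: idempotents_def bisection_carrier)
qed

lemma idempotent_bisections_commute:
  assumes "A \<in> idempotents (\<K> G)" "B \<in> idempotents (\<K> G)"
  shows "A \<otimes>\<^bsub>\<K> G\<^esub> B = B \<otimes>\<^bsub>\<K> G\<^esub> A"
proof -
  have "A \<otimes>\<^bsub>\<K> G\<^esub> B = A \<inter> B" if "A \<subseteq> {e. identity_arrow G e}" "B \<subseteq> {e. identity_arrow G e}" for A B
  proof -
    have I: "\<And>e. e \<in> A \<Longrightarrow> identity_arrow G e" "\<And>e. e \<in> B \<Longrightarrow> identity_arrow G e"
      using that by auto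
    have "A \<otimes>\<^bsub>\<K> G\<^esub> B = {a \<in> A. D a \<in> B}"
      by (rule mult_identities(1)[OF identities_bisection]) (use I in auto)
    then show ?thesis
      using I by auto
  qed
  then show ?thesis
    using assms by (auto simp: idempotent_bisections)
qed

end

text \<open>For inverses \<open>b, c\<close> of \<open>a\<close>, commuting \<open>ab\<close> with \<open>ac\<close> and \<open>ba\<close> with \<open>ca\<close> turns both \<open>b\<close> and \<open>c\<close>
  into \<open>bac\<close>.\<close>

lemma inverse_semigroupI:
  fixes S (structure)
  assumes closed: "\<And>a b. a \<in> carrier S \<Longrightarrow> b \<in> carrier S \<Longrightarrow> a \<otimes> b \<in> carrier S"
    and assoc: "\<And>a b c. a \<in> carrier S \<Longrightarrow> b \<in> carrier S \<Longrightarrow> c \<in> carrier S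
      \<Longrightarrow> (a \<otimes> b) \<otimes> c = a \<otimes> (b \<otimes> c)"
    and regular: "\<And>a. a \<in> carrier S \<Longrightarrow> \<exists>b. is_sg_inverse S a b"
    and commute: "\<And>e f. e \<in> idempotents S \<Longrightarrow> f \<in> idempotents S \<Longrightarrow> e \<otimes> f = f \<otimes> e"
  shows "inverse_semigroup S"
proof
  fix a
  assume a: "a \<in> carrier S"
  have "b = c" if "is_sg_inverse S a b" "is_sg_inverse S a c" for b c
  proof -
    have b: "b \<in> carrier S" "a \<otimes> (b \<otimes> a) = a" "b \<otimes> (a \<otimes> b) = b"
      and c: "c \<in> carrier S" "a \<otimes> (c \<otimes> a) = a" "c \<otimes> (a \<otimes> c) = c"
      using that a by (auto simp: is_sg_inverse_def assoc)
    have left: "x \<otimes> (y \<otimes> (x \<otimes> d)) = x \<otimes> d"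
      if "x \<otimes> (y \<otimes> x) = x" "x \<in> carrier S" "y \<in> carrier S" "d \<in> carrier S" for x y d
      using that by (metis assoc closed)
    have idem: "a \<otimes> b \<in> idempotents S" "a \<otimes> c \<in> idempotents S"
      "b \<otimes> a \<in> idempotents S" "c \<otimes> a \<in> idempotents S"
      using a b c by (auto simp: idempotents_def assoc closed left)
    have "b = b \<otimes> (a \<otimes> c \<otimes> (a \<otimes> b))"
      using a b c by (simp add: assoc closed left)
    also have "\<dots> = b \<otimes> (a \<otimes> b \<otimes> (a \<otimes> c))"
      using idem by (simp add: commute)
    also have "\<dots> = b \<otimes> a \<otimes> c"
      using a b c by (simp add: assoc closed left)
    finally have "b = b \<otimes> a \<otimes> c" .
    have "c = c \<otimes> a \<otimes> (b \<otimes> a) \<otimes> c"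
      using a b c by (simp add: assoc closed left)
    also have "\<dots> = b \<otimes> a \<otimes> (c \<otimes> a) \<otimes> c"
      using idem by (simp add: commute)
    also have "\<dots> = b \<otimes> a \<otimes> c"
      using a b c by (simp add: assoc closed left)
    finally show ?thesis using \<open>b = b \<otimes> a \<otimes> c\<close> by simp
  qed
  then show "\<exists>!b. is_sg_inverse S a b"
    using regular[OF a] by blast
qed (use closed assoc in auto)

section \<open>Powersets as Boolean algebras\<close>

text \<open>The order relation is only constrained on the carrier: the natural order of \<^term>\<open>\<K> G\<close> is
  inclusion between local bisections, but need not be inclusion between arbitrary sets of arrows.\<close>

lemma powerset_distributive_lattice:
  fixes L :: "('a set, 'b) gorder_scheme"
  assumes L: "carrier L = Pow X" "eq L = (=)" "\<And>A B. A \<subseteq> X \<Longrightarrow> B \<subseteq> X \<Longrightarrow> le L A B \<longleftrightarrow> A \<subseteq> B"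
  shows "distributive_lattice L" "bounded_lattice L"
    "\<And>A B. A \<subseteq> X \<Longrightarrow> B \<subseteq> X \<Longrightarrow> A \<squnion>\<^bsub>L\<^esub> B = A \<union> B"
    "\<And>A B. A \<subseteq> X \<Longrightarrow> B \<subseteq> X \<Longrightarrow> A \<sqinter>\<^bsub>L\<^esub> B = A \<inter> B"
    "\<bottom>\<^bsub>L\<^esub> = {}" "\<top>\<^bsub>L\<^esub> = X"
proof -
  have lub: "least L (A \<union> B) (Upper L {A, B})" if "A \<subseteq> X" "B \<subseteq> X" for A B
  proof -
    have "Upper L {A, B} = {U \<in> Pow X. A \<subseteq> U \<and> B \<subseteq> U}"
      unfolding Upper_def L(1) using that by (simp add: L(3) Int_def conj_commute cong: conj_cong) blast
    then show ?thesis
      unfolding least_def L(1) using that by (simp add: L(3) subset_iff)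
  qed
  have glb: "greatest L (A \<inter> B) (Lower L {A, B})" if "A \<subseteq> X" "B \<subseteq> X" for A B
  proof -
    have "Lower L {A, B} = {U \<in> Pow X. U \<subseteq> A \<and> U \<subseteq> B}"
      unfolding Lower_def L(1) using that by (simp add: L(3) Int_def conj_commute cong: conj_cong) blast
    then show ?thesis
      unfolding greatest_def L(1) using that by (simp add: L(3) le_infI1 subset_iff)
  qed
  have bot: "least L {} (carrier L)" and top: "greatest L X (carrier L)"
    by (auto simp: least_def greatest_def L(1) L(3))
  interpret partial_order L
    using L by unfold_locales auto
  have "least L \<bottom>\<^bsub>L\<^esub> (carrier L)"
    unfolding bottom_def by (rule someI, rule bot)
  then show "\<bottom>\<^bsub>L\<^esub> = {}"
    by (rule least_unique) (rule bot)
  have "greatest L \<top>\<^bsub>L\<^esub> (carrier L)"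
    unfolding top_def by (rule someI, rule top)
  then show "\<top>\<^bsub>L\<^esub> = X"
    by (rule greatest_unique) (rule top)
  show join: "A \<squnion>\<^bsub>L\<^esub> B = A \<union> B" if AB: "A \<subseteq> X" "B \<subseteq> X" for A B
  proof -
    have "least L (A \<squnion>\<^bsub>L\<^esub> B) (Upper L {A, B})"
      unfolding join_def sup_def by (rule someI, rule lub[OF AB])
    then show ?thesis
      by (rule least_unique) (rule lub[OF AB])
  qed
  show meet: "A \<sqinter>\<^bsub>L\<^esub> B = A \<inter> B" if AB: "A \<subseteq> X" "B \<subseteq> X" for A B
  proof -
    have "greatest L (A \<sqinter>\<^bsub>L\<^esub> B) (Lower L {A, B})"
      unfolding meet_def inf_def by (rule someI, rule glb[OF AB])
    then show ?thesis
      by (rule greatest_unique) (rule glb[OF AB])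
  qed
  interpret lattice L
  proof
    show "\<exists>s. least L s (Upper L {A, B})" if "A \<in> carrier L" "B \<in> carrier L" for A B
      by (rule exI, rule lub) (use that L(1) in simp_all)
    show "\<exists>s. greatest L s (Lower L {A, B})" if "A \<in> carrier L" "B \<in> carrier L" for A B
      by (rule exI, rule glb) (use that L(1) in simp_all)
  qed
  show "distributive_lattice L"
  proof
    fix A B C
    assume "A \<in> carrier L" "B \<in> carrier L" "C \<in> carrier L"
    then have "A \<subseteq> X" "B \<subseteq> X" "C \<subseteq> X" "A \<inter> B \<subseteq> X" "A \<inter> C \<subseteq> X" "B \<union> C \<subseteq> X"
      by (auto simp: L(1))
    then show "A \<sqinter>\<^bsub>L\<^esub> (B \<squnion>\<^bsub>L\<^esub> C) = (A \<sqinter>\<^bsub>L\<^esub> B) \<squnion>\<^bsub>L\<^esub> (A \<sqinter>\<^bsub>L\<^esub> C)"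
      by (simp add: join meet Int_Un_distrib)
  qed
  show "bounded_lattice L"
    by unfold_locales (rule exI, rule bot, rule exI, rule top)
qed

lemma powerset_unital_boolean_algebra:
  fixes L :: "('a set, 'b) gorder_scheme"
  assumes L: "carrier L = Pow X" "eq L = (=)" "\<And>A B. A \<subseteq> X \<Longrightarrow> B \<subseteq> X \<Longrightarrow> le L A B \<longleftrightarrow> A \<subseteq> B"
  shows "unital_boolean_algebra L"
proof -
  note P = powerset_distributive_lattice[OF L]
  interpret distributive_lattice L by (rule P)
  interpret bounded_lattice L by (rule P)
  show ?thesis
  proof
    fix A
    assume "A \<in> carrier L"
    then have "A \<subseteq> X" by (simp add: L(1))
    then have "A \<sqinter>\<^bsub>L\<^esub> (X - A) = \<bottom>\<^bsub>L\<^esub>" "A \<squnion>\<^bsub>L\<^esub> (X - A) = \<top>\<^bsub>L\<^esub>"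
      by (simp_all add: P Un_absorb1)
    then show "\<exists>B\<in>carrier L. A \<sqinter>\<^bsub>L\<^esub> B = \<bottom>\<^bsub>L\<^esub> \<and> A \<squnion>\<^bsub>L\<^esub> B = \<top>\<^bsub>L\<^esub>"
      by (intro bexI[of _ "X - A"]) (simp_all add: L(1))
  qed
qed

lemma powerset_generalized_boolean_algebra:
  fixes L :: "('a set, 'b) gorder_scheme"
  assumes L: "carrier L = Pow X" "eq L = (=)" "\<And>A B. A \<subseteq> X \<Longrightarrow> B \<subseteq> X \<Longrightarrow> le L A B \<longleftrightarrow> A \<subseteq> B"
  shows "generalized_boolean_algebra L"
proof -
  note P = powerset_distributive_lattice[OF L]
  interpret distributive_lattice L by (rule P)
  interpret bounded_lattice L by (rule P)
  show ?thesis
  proof (intro generalized_boolean_algebra.intro generalized_boolean_algebra_axioms.intro)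
    show "distributive_lattice L" "weak_partial_order_bottom L" ..
    fix A
    assume "A \<in> carrier L"
    then have A: "A \<subseteq> X" by (simp add: L(1))
    show "unital_boolean_algebra (principal_ideal L A)"
    proof (rule powerset_unital_boolean_algebra[where X = A])
      show "carrier (principal_ideal L A) = Pow A"
        using A L by (auto simp: principal_ideal_def)
    qed (use A L in \<open>auto simp: principal_ideal_def\<close>)
  qed
qed


section \<open>The Boolean inverse monoid of local bisections\<close>

context groupoid
begin

lemma bisection_is_inverse:
  assumes A: "local_bisection G A"
  shows "is_sg_inverse (\<K> G) A (arrow_inv G ` A)"
proof -
  have I: "identity_arrow G e" if "e \<in> D ` A \<or> e \<in> R ` A" for e
    using that bisection_closed[OF A] by auto
  have "D ` A \<otimes>\<^bsub>\<K> G\<^esub> arrow_inv G ` A = {b \<in> arrow_inv G ` A. R b \<in> D ` A}"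
    by (rule mult_identities(2)[OF bisection_inverse_closed[OF A]]) (rule I, blast)
  moreover have "R b \<in> D ` A" if "b \<in> arrow_inv G ` A" for b
    using that bisection_closed[OF A] by auto
  moreover have "R ` A \<otimes>\<^bsub>\<K> G\<^esub> A = {a \<in> A. R a \<in> R ` A}"
    by (rule mult_identities(2)[OF A]) (rule I, blast)
  ultimately show ?thesis
    using bisection_inverse_closed[OF A] bisection_inverse_mult[OF A]
    by (auto simp: is_sg_inverse_def bisection_carrier)
qed

lemma bisections_inverse_semigroup: "inverse_semigroup (\<K> G)"
proof (rule inverse_semigroupI)
  show "\<exists>B. is_sg_inverse (\<K> G) A B" if "A \<in> carrier (\<K> G)" for A
    using that bisection_is_inverse by (auto simp: bisection_carrier)
qed (simp_all add: bisection_carrier bisection_mult_closed bisection_mult_assoc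
    bisection_subset_carrier idempotent_bisections_commute)

lemma bisection_inverse:
  assumes "local_bisection G A"
  shows "sg_inv (\<K> G) A = arrow_inv G ` A"
  using inverse_semigroup.is_inverse_unique[OF bisections_inverse_semigroup, of A "arrow_inv G ` A"]
    bisection_is_inverse[OF assms] assms by (simp add: bisection_carrier)

text \<open>The product \<open>B(A\<^sup>-A)\<close> consists of the arrows of \<open>B\<close> that share their domain with an arrow of \<open>A\<close>.
  As \<open>B\<close> has at most one arrow with a given domain, it equals \<open>A\<close> exactly when \<open>A \<subseteq> B\<close>.\<close>

lemma bisection_order:
  assumes A: "local_bisection G A" and B: "local_bisection G B"
  shows "A \<sqsubseteq>\<^bsub>natural_order (\<K> G)\<^esub> B \<longleftrightarrow> A \<subseteq> B"
proof -
  have I: "identity_arrow G e" if "e \<in> D ` A" for e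
    using that bisection_closed[OF A] by auto
  have "B \<otimes>\<^bsub>\<K> G\<^esub> sg_inv (\<K> G) A \<otimes>\<^bsub>\<K> G\<^esub> A = B \<otimes>\<^bsub>\<K> G\<^esub> (D ` A)"
    using A B by (simp add: bisection_inverse bisection_mult_assoc bisection_inverse_closed
        bisection_subset_carrier bisection_inverse_mult)
  also have "\<dots> = {b \<in> B. D b \<in> D ` A}"
    using mult_identities(1)[OF B I] .
  finally have "A \<sqsubseteq>\<^bsub>natural_order (\<K> G)\<^esub> B \<longleftrightarrow> A = {b \<in> B. D b \<in> D ` A}"
    by (simp add: natural_order_def)
  also have "\<dots> \<longleftrightarrow> A \<subseteq> B"
    using bisection_dom_inj[OF B] by blast
  finally show ?thesis .
qed

text \<open>If \<open>a \<in> A\<close> and \<open>b \<in> B\<close> have the same range, then \<open>a\<^sup>-b\<close> lies in the idempotent \<open>A\<^sup>-B\<close>, so it is an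
  identity and \<open>a = b\<close>; the same argument for domains uses \<open>AB\<^sup>-\<close>.\<close>

lemma compatible_union_bisection:
  assumes A: "local_bisection G A" and B: "local_bisection G B" and AB: "compatible (\<K> G) A B"
  shows "local_bisection G (A \<union> B)"
proof -
  have "arrow_inv G ` A \<otimes>\<^bsub>\<K> G\<^esub> B \<subseteq> {e. identity_arrow G e}"
    and "A \<otimes>\<^bsub>\<K> G\<^esub> arrow_inv G ` B \<subseteq> {e. identity_arrow G e}"
    using AB A B by (auto simp: compatible_def bisection_inverse idempotent_bisections)
  then have id1: "\<And>a b. a \<in> A \<Longrightarrow> b \<in> B \<Longrightarrow> D (a\<^sup>-) = R b \<Longrightarrow> identity_arrow G (a\<^sup>- \<bullet> b)"
    and id2: "\<And>a b. a \<in> A \<Longrightarrow> b \<in> B \<Longrightarrow> D a = R (b\<^sup>-) \<Longrightarrow> identity_arrow G (a \<bullet> b\<^sup>-)"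
    unfolding bisection_mult by blast+
  have ran: "a = b" if ab: "a \<in> A" "b \<in> B" "R a = R b" for a b
  proof -
    have C: "a \<in> carrier G" "b \<in> carrier G"
      using ab bisection_closed A B by auto
    have "D (a\<^sup>-) = R b"
      using C ab by simp
    then have "identity_arrow G (a\<^sup>- \<bullet> b)"
      using id1 ab by blast
    then have "a\<^sup>- \<bullet> b = D a"
      using ran_identity ran_comp \<open>D (a\<^sup>-) = R b\<close> dom_ran_inverse(2) arrow_inverse_closed C by metis
    have "b = a \<bullet> a\<^sup>- \<bullet> b"
      using C ab by simp
    also have "\<dots> = a \<bullet> (a\<^sup>- \<bullet> b)"
      using C ab by (intro comp_assoc_total) simp_all
    finally show ?thesis
      using \<open>a\<^sup>- \<bullet> b = D a\<close> C by simp
  qed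
  have dom: "a = b" if ab: "a \<in> A" "b \<in> B" "D a = D b" for a b
  proof -
    have C: "a \<in> carrier G" "b \<in> carrier G"
      using ab bisection_closed A B by auto
    have "D a = R (b\<^sup>-)"
      using C ab by simp
    then have "identity_arrow G (a \<bullet> b\<^sup>-)"
      using id2 ab by blast
    then have "a \<bullet> b\<^sup>- = R b"
      using dom_identity dom_comp \<open>D a = R (b\<^sup>-)\<close> dom_ran_inverse(1) arrow_inverse_closed C by metis
    have "a = a \<bullet> (b\<^sup>- \<bullet> b)"
      using C ab comp_dom_ran(1)[of a] by simp
    also have "\<dots> = a \<bullet> b\<^sup>- \<bullet> b"
      using C ab by (intro comp_assoc_total[symmetric]) simp_all
    finally show ?thesis
      using \<open>a \<bullet> b\<^sup>- = R b\<close> C by simp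
  qed
  show ?thesis
  proof (rule bisectionI)
    show "A \<union> B \<subseteq> carrier G"
      using A B bisection_subset_carrier by simp
    show "a = b" if "a \<in> A \<union> B" "b \<in> A \<union> B" "D a = D b" for a b
      using that dom[of a b] dom[of b a] bisection_dom_inj[OF A, of a b] bisection_dom_inj[OF B, of a b]
      by auto
    show "a = b" if "a \<in> A \<union> B" "b \<in> A \<union> B" "R a = R b" for a b
      using that ran[of a b] ran[of b a] bisection_ran_inj[OF A, of a b] bisection_ran_inj[OF B, of a b]
      by auto
  qed
qed

lemma bisection_join:
  assumes A: "local_bisection G A" and B: "local_bisection G B" and AB: "local_bisection G (A \<union> B)"
  shows "is_sg_join (\<K> G) A B J \<longleftrightarrow> J = A \<union> B"
proof -
  have "is_sg_join (\<K> G) A B J \<longleftrightarrow>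
    J \<in> carrier (\<K> G) \<and> A \<sqsubseteq>\<^bsub>natural_order (\<K> G)\<^esub> J \<and> B \<sqsubseteq>\<^bsub>natural_order (\<K> G)\<^esub> J \<and>
    (\<forall>U\<in>carrier (\<K> G). A \<sqsubseteq>\<^bsub>natural_order (\<K> G)\<^esub> U \<longrightarrow> B \<sqsubseteq>\<^bsub>natural_order (\<K> G)\<^esub> U
      \<longrightarrow> J \<sqsubseteq>\<^bsub>natural_order (\<K> G)\<^esub> U)"
    by (rule inverse_semigroup.is_join_iff[OF bisections_inverse_semigroup])
      (simp_all add: bisection_carrier A B)
  also have "\<dots> \<longleftrightarrow> local_bisection G J \<and> A \<subseteq> J \<and> B \<subseteq> J \<and>
    (\<forall>U. local_bisection G U \<longrightarrow> A \<subseteq> U \<longrightarrow> B \<subseteq> U \<longrightarrow> J \<subseteq> U)"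
    by (simp add: Ball_def bisection_carrier bisection_order A B cong: conj_cong imp_cong)
  also have "\<dots> \<longleftrightarrow> J = A \<union> B"
    using AB by blast
  finally show ?thesis .
qed

lemma empty_bisection: "local_bisection G {}"
  by (simp add: local_bisection_def)

lemma bisection_zero: "sg_zero (\<K> G) = {}"
proof -
  have "is_sg_zero (\<K> G) {}"
    using empty_bisection by (auto simp: is_sg_zero_def bisection_carrier bisection_mult)
  then show ?thesis
    using is_zero_sg_zero[of "\<K> G"] unfolding is_sg_zero_def by metis
qed

text \<open>The order is inclusion, so compatible joins are unions, over which the elementwise product
  distributes, and the idempotents are all the sets of identities, that is, a powerset.  Nonemptiness of
  the groupoid keeps the monoid from collapsing to the empty bisection.\<close>

theorem bisections_boolean_inverse_monoid:
  assumes "carrier G \<noteq> {}"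
  shows "boolean_inverse_monoid (\<K> G)"
proof -
  interpret K: inverse_semigroup "\<K> G"
    by (rule bisections_inverse_semigroup)
  have union: "local_bisection G (A \<union> B) \<and> (is_sg_join (\<K> G) A B J \<longleftrightarrow> J = A \<union> B)"
    if "A \<in> carrier (\<K> G)" "B \<in> carrier (\<K> G)" "compatible (\<K> G) A B" for A B J
    using that compatible_union_bisection bisection_join by (simp add: bisection_carrier)
  have distributive: "distributive_inverse_semigroup (\<K> G)"
  proof
    show "\<exists>z. is_sg_zero (\<K> G) z"
      using empty_bisection
      by (intro exI[of _ "{}"]) (auto simp: is_sg_zero_def bisection_carrier bisection_mult)
    show "\<exists>J. is_sg_join (\<K> G) A B J"
      if "A \<in> carrier (\<K> G)" "B \<in> carrier (\<K> G)" "compatible (\<K> G) A B" for A B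
      using union that by blast
    fix A B C J
    assume *: "A \<in> carrier (\<K> G)" "B \<in> carrier (\<K> G)" "C \<in> carrier (\<K> G)"
      "compatible (\<K> G) A B" "is_sg_join (\<K> G) A B J"
    then have J: "J = A \<union> B" "local_bisection G J"
      using union[of A B J] by simp_all
    have "C \<otimes>\<^bsub>\<K> G\<^esub> J = C \<otimes>\<^bsub>\<K> G\<^esub> A \<union> C \<otimes>\<^bsub>\<K> G\<^esub> B" "J \<otimes>\<^bsub>\<K> G\<^esub> C = A \<otimes>\<^bsub>\<K> G\<^esub> C \<union> B \<otimes>\<^bsub>\<K> G\<^esub> C"
      unfolding J(1) bisection_mult by blast+
    moreover have "local_bisection G (C \<otimes>\<^bsub>\<K> G\<^esub> J)" "local_bisection G (J \<otimes>\<^bsub>\<K> G\<^esub> C)"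
      using J * bisection_mult_closed by (auto simp: bisection_carrier)
    ultimately show "is_sg_join (\<K> G) (C \<otimes>\<^bsub>\<K> G\<^esub> A) (C \<otimes>\<^bsub>\<K> G\<^esub> B) (C \<otimes>\<^bsub>\<K> G\<^esub> J)"
      and "is_sg_join (\<K> G) (A \<otimes>\<^bsub>\<K> G\<^esub> C) (B \<otimes>\<^bsub>\<K> G\<^esub> C) (J \<otimes>\<^bsub>\<K> G\<^esub> C)"
      using * by (auto simp: bisection_carrier bisection_mult_closed bisection_join)
  qed
  have boolean: "boolean_inverse_semigroup (\<K> G)"
  proof (intro boolean_inverse_semigroup.intro boolean_inverse_semigroup_axioms.intro)
    show "generalized_boolean_algebra (idempotent_order (\<K> G))"
    proof (rule powerset_generalized_boolean_algebra[where X = "{e. identity_arrow G e}"])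
      show "A \<sqsubseteq>\<^bsub>idempotent_order (\<K> G)\<^esub> B \<longleftrightarrow> A \<subseteq> B"
        if "A \<subseteq> {e. identity_arrow G e}" "B \<subseteq> {e. identity_arrow G e}" for A B
      proof -
        have "local_bisection G A" "local_bisection G B"
          by (rule identities_bisection, use that in blast)+
        then show ?thesis
          using bisection_order by (simp add: idempotent_order_def)
      qed
    qed (simp_all add: idempotent_order_def natural_order_def idempotent_bisections)
    obtain x where "x \<in> carrier G"
      using assms by blast
    then have "{D x} \<in> carrier (\<K> G)"
      using identities_bisection[of "{D x}"] by (simp add: bisection_carrier)
    then show "carrier (\<K> G) \<noteq> {sg_zero (\<K> G)}"
      by (auto simp: bisection_zero)
  qed (rule distributive)
  have "monoid (\<K> G)"
  proof
    show "\<one>\<^bsub>\<K> G\<^esub> \<in> carrier (\<K> G)"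
      using identities_bisection[of "{e. identity_arrow G e}"]
      by (simp add: bisection_carrier bisection_one)
    show "\<one>\<^bsub>\<K> G\<^esub> \<otimes>\<^bsub>\<K> G\<^esub> A = A" "A \<otimes>\<^bsub>\<K> G\<^esub> \<one>\<^bsub>\<K> G\<^esub> = A" if "A \<in> carrier (\<K> G)" for A
      using that mult_identities[of A "\<one>\<^bsub>\<K> G\<^esub>"] bisection_closed
      by (auto simp: bisection_carrier bisection_one)
  qed (simp_all add: K.sg_assoc)
  then show ?thesis
    using boolean by (simp add: boolean_inverse_monoid_def)
qed

end


section \<open>The groupoid of atoms\<close>

context distributive_inverse_semigroup
begin

abbreviation null :: 'a  (\<open>\<zero>\<close>)
  where "\<zero> \<equiv> sg_zero S"

lemma null_closed [simp]: "\<zero> \<in> carrier S"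
  using is_zero_sg_zero[OF zero_exists] by (simp add: is_sg_zero_def)

lemma mult_null [simp]:
  assumes "a \<in> carrier S"
  shows "\<zero> \<otimes> a = \<zero>" "a \<otimes> \<zero> = \<zero>"
  using is_zero_sg_zero[OF zero_exists] assms by (simp_all add: is_sg_zero_def)

lemma null_idempotent [simp]: "\<zero> \<in> E"
  by (rule idempotentI) simp_all

lemma null_below [simp]: "a \<in> carrier S \<Longrightarrow> \<zero> \<preceq> a"
  using restriction_below[of a "\<zero>"] by simp

lemma below_null: "a \<in> carrier S \<Longrightarrow> a \<preceq> \<zero> \<Longrightarrow> a = \<zero>"
  using below_restriction[of a "\<zero>"] by simp

lemma dom_eq_null: "a \<in> carrier S \<Longrightarrow> a\<^sup>\<star> \<otimes> a = \<zero> \<Longrightarrow> a = \<zero>"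
  using mult_inverse_mult(1)[of a] by simp

lemma atomI:
  assumes "a \<in> carrier S" "a \<noteq> \<zero>" "\<And>x. x \<in> carrier S \<Longrightarrow> x \<preceq> a \<Longrightarrow> x \<noteq> \<zero> \<Longrightarrow> x = a"
  shows "a \<in> atoms S"
  unfolding atoms_def using assms by blast

lemma atom_closed [simp]: "a \<in> atoms S \<Longrightarrow> a \<in> carrier S"
  unfolding atoms_def by blast

lemma atom_nonzero: "a \<in> atoms S \<Longrightarrow> a \<noteq> \<zero>"
  unfolding atoms_def by blast

lemma below_atom: "a \<in> atoms S \<Longrightarrow> x \<in> carrier S \<Longrightarrow> x \<preceq> a \<Longrightarrow> x \<noteq> \<zero> \<Longrightarrow> x = a"
  unfolding atoms_def by blast

lemma inverse_eq_null:
  assumes "a \<in> carrier S" "a\<^sup>\<star> = \<zero>"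
  shows "a = \<zero>"
  using mult_inverse_mult(1)[OF assms(1)] assms by simp

lemma inverse_atom [simp]:
  assumes a: "a \<in> atoms S"
  shows "a\<^sup>\<star> \<in> atoms S"
proof (rule atomI)
  show "a\<^sup>\<star> \<noteq> \<zero>"
    using inverse_eq_null[OF atom_closed[OF a]] atom_nonzero[OF a] by blast
  fix x
  assume x: "x \<in> carrier S" "x \<preceq> a\<^sup>\<star>" "x \<noteq> \<zero>"
  have "x\<^sup>\<star> \<noteq> \<zero>"
    using inverse_eq_null[OF x(1)] x(3) by blast
  moreover have "x\<^sup>\<star> \<preceq> a"
    using inverse_mono[of x "a\<^sup>\<star>"] x a by simp
  ultimately have "x\<^sup>\<star> = a"
    using below_atom[OF a] x by simp
  then show "x = a\<^sup>\<star>"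
    using inverse_inverse[OF x(1)] by simp
qed (use a in simp)

text \<open>The map \<open>e \<mapsto> ae\<close> embeds the idempotents below \<open>a\<^sup>\<star>a\<close> into the elements below \<open>a\<close>, with
  \<open>a\<^sup>\<star>(ae) = e\<close>, so the minimality of \<open>a\<close> passes to \<open>a\<^sup>\<star>a\<close>.\<close>

lemma dom_atom [simp]:
  assumes a: "a \<in> atoms S"
  shows "a\<^sup>\<star> \<otimes> a \<in> atoms S"
proof (rule atomI)
  show "a\<^sup>\<star> \<otimes> a \<noteq> \<zero>"
    using dom_eq_null atom_nonzero a by force
  fix e
  assume e: "e \<in> carrier S" "e \<preceq> a\<^sup>\<star> \<otimes> a" "e \<noteq> \<zero>"
  have "e \<in> E"
    by (rule below_idempotent[OF e(1) _ e(2)]) (use a in simp)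
  then have de: "a\<^sup>\<star> \<otimes> a \<otimes> e = e"
    using e a by (simp add: idempotent_below_iff)
  have "a \<otimes> e \<noteq> \<zero>"
    using de e a by (auto simp: sg_assoc)
  then have "a \<otimes> e = a"
    using below_atom[OF a] restriction_below a e \<open>e \<in> E\<close> by simp
  then show "e = a\<^sup>\<star> \<otimes> a"
    using de a e by (simp add: sg_assoc)
qed (use a in simp)

text \<open>Conversely, an element \<open>x \<le> a\<close> is determined by its domain, which lies below \<open>a\<^sup>\<star>a\<close>.\<close>

lemma atom_if_dom_atom:
  assumes a: "a \<in> carrier S" and dom: "a\<^sup>\<star> \<otimes> a \<in> atoms S"
  shows "a \<in> atoms S"
proof (rule atomI)
  show "a \<noteq> \<zero>"
    using atom_nonzero[OF dom] a by auto
  fix x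
  assume x: "x \<in> carrier S" "x \<preceq> a" "x \<noteq> \<zero>"
  have "x\<^sup>\<star> \<otimes> x \<noteq> \<zero>"
    using dom_eq_null[OF x(1)] x(3) by blast
  then have "x\<^sup>\<star> \<otimes> x = a\<^sup>\<star> \<otimes> a"
    using below_atom[OF dom] dom_mono x a by simp
  then show "x = a"
    using below_eq_of_dom_eq[OF x(1) a a x(2)] a by simp
qed (rule a)

lemma ran_atom [simp]: "a \<in> atoms S \<Longrightarrow> a \<otimes> a\<^sup>\<star> \<in> atoms S"
  using dom_atom[of "a\<^sup>\<star>"] by simp

lemma dom_ran_restricted_product:
  assumes "a \<in> carrier S" "b \<in> carrier S" and ab: "a\<^sup>\<star> \<otimes> a = b \<otimes> b\<^sup>\<star>"
  shows "(a \<otimes> b)\<^sup>\<star> \<otimes> (a \<otimes> b) = b\<^sup>\<star> \<otimes> b" "(a \<otimes> b) \<otimes> (a \<otimes> b)\<^sup>\<star> = a \<otimes> a\<^sup>\<star>"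
proof -
  have "(a \<otimes> b)\<^sup>\<star> \<otimes> (a \<otimes> b) = b\<^sup>\<star> \<otimes> (a\<^sup>\<star> \<otimes> a) \<otimes> b"
    using assms(1,2) by (simp add: inverse_mult sg_assoc)
  then show "(a \<otimes> b)\<^sup>\<star> \<otimes> (a \<otimes> b) = b\<^sup>\<star> \<otimes> b"
    unfolding ab using assms(1,2) by (simp add: sg_assoc inverse_cancel)
  have "(a \<otimes> b) \<otimes> (a \<otimes> b)\<^sup>\<star> = a \<otimes> (b \<otimes> b\<^sup>\<star>) \<otimes> a\<^sup>\<star>"
    using assms(1,2) by (simp add: inverse_mult sg_assoc)
  then show "(a \<otimes> b) \<otimes> (a \<otimes> b)\<^sup>\<star> = a \<otimes> a\<^sup>\<star>"
    unfolding ab[symmetric] using assms(1,2) by (simp add: sg_assoc inverse_cancel)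
qed

lemma restricted_product_atom:
  assumes "a \<in> atoms S" "b \<in> atoms S" "a\<^sup>\<star> \<otimes> a = b \<otimes> b\<^sup>\<star>"
  shows "a \<otimes> b \<in> atoms S"
  by (rule atom_if_dom_atom) (use assms in \<open>simp_all add: dom_ran_restricted_product\<close>)

lemma atom_carrier: "carrier (\<A> S) = atoms S"
  by (simp add: atom_groupoid_def)

lemma atom_pcomp_iff:
  "pcomp (\<A> S) a b = Some c \<longleftrightarrow>
    a \<in> atoms S \<and> b \<in> atoms S \<and> a\<^sup>\<star> \<otimes> a = b \<otimes> b\<^sup>\<star> \<and> c = a \<otimes> b"
  by (auto simp: atom_groupoid_def sg_dom_def sg_ran_def)

text \<open>An identity arrow \<open>e\<close> acts neutrally on its own domain \<open>d\<close>, while \<open>ed = e\<close>; so \<open>e = d\<close> is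
  idempotent.\<close>

lemma identity_atom_iff: "identity_arrow (\<A> S) e \<longleftrightarrow> e \<in> atoms S \<and> e \<in> E"
proof
  assume id: "identity_arrow (\<A> S) e"
  then have e: "e \<in> atoms S"
    by (simp add: identity_arrow_def atom_carrier)
  have "pcomp (\<A> S) e (e\<^sup>\<star> \<otimes> e) = Some e"
    unfolding atom_pcomp_iff using e by (simp add: inverse_cancel)
  then have "e = e\<^sup>\<star> \<otimes> e"
    using id dom_atom[OF e] unfolding identity_arrow_def atom_carrier by blast
  then have "e \<in> E"
    using dom_idempotent[of e] e by simp
  then show "e \<in> atoms S \<and> e \<in> E"
    using e by blast
next
  assume e: "e \<in> atoms S \<and> e \<in> E"
  show "identity_arrow (\<A> S) e"
    unfolding identity_arrow_def atom_carrier atom_pcomp_iff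
  proof (intro conjI ballI allI impI; (elim conjE)?)
    show "e \<in> atoms S" using e by simp
    fix x y
    assume x: "x \<in> atoms S"
    show "y = x" if "e\<^sup>\<star> \<otimes> e = x \<otimes> x\<^sup>\<star>" "y = e \<otimes> x"
    proof -
      have "e = x \<otimes> x\<^sup>\<star>"
        using that(1) e by simp
      then have "y = x \<otimes> x\<^sup>\<star> \<otimes> x"
        using that(2) by simp
      then show ?thesis
        using x by (simp add: sg_assoc inverse_cancel)
    qed
    show "y = x" if "x\<^sup>\<star> \<otimes> x = e \<otimes> e\<^sup>\<star>" "y = x \<otimes> e"
    proof -
      have "e = x\<^sup>\<star> \<otimes> x"
        using that(1) e by simp
      then have "y = x \<otimes> (x\<^sup>\<star> \<otimes> x)"
        using that(2) by simp
      then show ?thesis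
        using x by (simp add: inverse_cancel)
    qed
  qed
qed

lemma inverse_is_arrow_inverse:
  assumes "x \<in> atoms S"
  shows "is_arrow_inverse (\<A> S) x (x\<^sup>\<star>)"
  unfolding is_arrow_inverse_def atom_carrier atom_pcomp_iff identity_atom_iff
  using assms by simp

text \<open>Both sides of the associative law are defined exactly when \<open>x\<^sup>\<star>x = yy\<^sup>\<star>\<close> and
  \<open>y\<^sup>\<star>y = zz\<^sup>\<star>\<close>, because a restricted product \<open>xy\<close> has the domain of \<open>y\<close> and the range of \<open>x\<close>.\<close>

lemma atoms_groupoid: "groupoid (\<A> S)"
proof
  show "x \<in> carrier (\<A> S) \<and> y \<in> carrier (\<A> S) \<and> z \<in> carrier (\<A> S)"
    if "pcomp (\<A> S) x y = Some z" for x y z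
    using that restricted_product_atom by (simp add: atom_pcomp_iff atom_carrier)
  have defined: "pcomp (\<A> S) x y = (if x\<^sup>\<star> \<otimes> x = y \<otimes> y\<^sup>\<star> then Some (x \<otimes> y) else None)"
    if "x \<in> atoms S" "y \<in> atoms S" for x y
    using that by (simp add: atom_groupoid_def sg_dom_def sg_ran_def)
  show "Option.bind (pcomp (\<A> S) x y) (\<lambda>u. pcomp (\<A> S) u z) =
      Option.bind (pcomp (\<A> S) y z) (\<lambda>v. pcomp (\<A> S) x v)"
    if "x \<in> carrier (\<A> S)" "y \<in> carrier (\<A> S)" "z \<in> carrier (\<A> S)" for x y z
  proof -
    have A: "x \<in> atoms S" "y \<in> atoms S" "z \<in> atoms S"
      using that by (simp_all add: atom_carrier)
    have assoc: "x \<otimes> y \<otimes> z = x \<otimes> (y \<otimes> z)"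
      using A by (simp add: sg_assoc)
    show ?thesis
    proof (cases "x\<^sup>\<star> \<otimes> x = y \<otimes> y\<^sup>\<star>"; cases "y\<^sup>\<star> \<otimes> y = z \<otimes> z\<^sup>\<star>")
      assume "x\<^sup>\<star> \<otimes> x = y \<otimes> y\<^sup>\<star>" "y\<^sup>\<star> \<otimes> y = z \<otimes> z\<^sup>\<star>"
      then show ?thesis
        using A by (simp add: defined restricted_product_atom dom_ran_restricted_product assoc)
    qed (use A in \<open>simp_all add: defined restricted_product_atom dom_ran_restricted_product\<close>)
  qed
  show "pcomp (\<A> S) u z \<noteq> None"
    if "pcomp (\<A> S) x y = Some u" "pcomp (\<A> S) y z = Some v" for x y z u v
    using that by (simp add: atom_pcomp_iff restricted_product_atom dom_ran_restricted_product)
  show "\<exists>e. identity_arrow (\<A> S) e \<and> pcomp (\<A> S) x e \<noteq> None" if "x \<in> carrier (\<A> S)" for x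
    using that by (intro exI[of _ "x\<^sup>\<star> \<otimes> x"]) (simp add: identity_atom_iff atom_carrier atom_pcomp_iff)
  show "\<exists>f. identity_arrow (\<A> S) f \<and> pcomp (\<A> S) f x \<noteq> None" if "x \<in> carrier (\<A> S)" for x
    using that by (intro exI[of _ "x \<otimes> x\<^sup>\<star>"]) (simp add: identity_atom_iff atom_carrier atom_pcomp_iff)
  show "\<exists>y. is_arrow_inverse (\<A> S) x y" if "x \<in> carrier (\<A> S)" for x
    using that inverse_is_arrow_inverse by (auto simp: atom_carrier)
qed

lemma atom_dom_ran:
  assumes x: "x \<in> atoms S"
  shows "arrow_dom (\<A> S) x = x\<^sup>\<star> \<otimes> x" "arrow_ran (\<A> S) x = x \<otimes> x\<^sup>\<star>"
proof -
  have inv: "arrow_inv (\<A> S) x = x\<^sup>\<star>"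
    by (rule groupoid.arrow_inverse_eq[OF atoms_groupoid])
      (simp_all add: x atom_carrier inverse_is_arrow_inverse)
  have "pcomp (\<A> S) (x\<^sup>\<star>) x = Some (x\<^sup>\<star> \<otimes> x)" "pcomp (\<A> S) x (x\<^sup>\<star>) = Some (x \<otimes> x\<^sup>\<star>)"
    using x by (simp_all add: atom_pcomp_iff)
  then show "arrow_dom (\<A> S) x = x\<^sup>\<star> \<otimes> x" "arrow_ran (\<A> S) x = x \<otimes> x\<^sup>\<star>"
    by (simp_all add: arrow_dom_def arrow_ran_def inv)
qed

lemma atom_bisection_iff:
  "local_bisection (\<A> S) A \<longleftrightarrow> A \<subseteq> atoms S \<and>
    (\<forall>a\<in>A. \<forall>b\<in>A. (a\<^sup>\<star> \<otimes> a = b\<^sup>\<star> \<otimes> b \<longrightarrow> a = b) \<and> (a \<otimes> a\<^sup>\<star> = b \<otimes> b\<^sup>\<star> \<longrightarrow> a = b))"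
  unfolding local_bisection_def atom_carrier
  by (intro conj_cong refl ball_cong) (simp_all add: atom_dom_ran subset_iff)

lemma atom_bisection_mult:
  assumes "A \<subseteq> atoms S" "B \<subseteq> atoms S"
  shows "A \<otimes>\<^bsub>\<K> (\<A> S)\<^esub> B = {a \<otimes> b | a b. a \<in> A \<and> b \<in> B \<and> a\<^sup>\<star> \<otimes> a = b \<otimes> b\<^sup>\<star>}"
proof -
  have "arrow_dom (\<A> S) a = arrow_ran (\<A> S) b \<longleftrightarrow> a\<^sup>\<star> \<otimes> a = b \<otimes> b\<^sup>\<star>"
    and "a\<^sup>\<star> \<otimes> a = b \<otimes> b\<^sup>\<star> \<Longrightarrow> the (pcomp (\<A> S) a b) = a \<otimes> b" if "a \<in> A" "b \<in> B" for a b
  proof -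
    have ab: "a \<in> atoms S" "b \<in> atoms S"
      using that assms by auto
    show "arrow_dom (\<A> S) a = arrow_ran (\<A> S) b \<longleftrightarrow> a\<^sup>\<star> \<otimes> a = b \<otimes> b\<^sup>\<star>"
      using ab by (simp add: atom_dom_ran)
    show "the (pcomp (\<A> S) a b) = a \<otimes> b" if "a\<^sup>\<star> \<otimes> a = b \<otimes> b\<^sup>\<star>"
      using that ab by (simp add: atom_groupoid_def sg_dom_def sg_ran_def)
  qed
  then show ?thesis
    unfolding local_bisection_monoid_def monoid.simps
    by (intro Collect_cong ex_cong1) (metis (no_types, lifting))
qed


section \<open>The atoms below an element\<close>

definition atoms_below :: "'a \<Rightarrow> 'a set"
  where "atoms_below a = {x \<in> atoms S. x \<preceq> a}"

lemma atoms_below_iff: "x \<in> atoms_below a \<longleftrightarrow> x \<in> atoms S \<and> x \<preceq> a"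
  by (simp add: atoms_below_def)

text \<open>Two atoms below \<open>a\<close> with the same domain \<open>d\<close> are both equal to \<open>ad\<close>; passing to inverses gives
  the statement for ranges.\<close>

lemma atoms_below_bisection:
  assumes a: "a \<in> carrier S"
  shows "local_bisection (\<A> S) (atoms_below a)"
  unfolding atom_bisection_iff
proof (intro conjI ballI impI)
  show "atoms_below a \<subseteq> atoms S"
    by (auto simp: atoms_below_def)
  fix x y
  assume "x \<in> atoms_below a" "y \<in> atoms_below a"
  then have xy: "x \<in> carrier S" "y \<in> carrier S" "x \<preceq> a" "y \<preceq> a"
    by (simp_all add: atoms_below_iff)
  show "x = y" if "x\<^sup>\<star> \<otimes> x = y\<^sup>\<star> \<otimes> y"
    using below_eq_of_dom_eq xy a that by blast
  show "x = y" if "x \<otimes> x\<^sup>\<star> = y \<otimes> y\<^sup>\<star>"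
  proof -
    have "x\<^sup>\<star> = y\<^sup>\<star>"
      by (rule below_eq_of_dom_eq[of _ _ "a\<^sup>\<star>"]) (use xy a that in \<open>simp_all add: inverse_mono\<close>)
    then show ?thesis
      using inverse_inverse xy(1,2) by metis
  qed
qed

text \<open>An atom \<open>z \<le> ab\<close> with domain \<open>d\<close> is \<open>abd\<close>; it factors as \<open>xy\<close> with \<open>y = bd\<close> and
  \<open>x = a\<close> restricted to the range of \<open>y\<close>.  Both factors are nonzero, so all the idempotents
  involved are atoms and the product is restricted.\<close>

lemma atoms_below_mult:
  assumes a: "a \<in> carrier S" and b: "b \<in> carrier S"
  shows "atoms_below (a \<otimes> b) = atoms_below a \<otimes>\<^bsub>\<K> (\<A> S)\<^esub> atoms_below b"
proof -
  have mult: "atoms_below a \<otimes>\<^bsub>\<K> (\<A> S)\<^esub> atoms_below b =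
      {x \<otimes> y | x y. x \<in> atoms_below a \<and> y \<in> atoms_below b \<and> x\<^sup>\<star> \<otimes> x = y \<otimes> y\<^sup>\<star>}"
    by (rule atom_bisection_mult) (auto simp: atoms_below_def)
  have product: "x \<otimes> y \<in> atoms_below (a \<otimes> b)"
    if "x \<in> atoms_below a" "y \<in> atoms_below b" "x\<^sup>\<star> \<otimes> x = y \<otimes> y\<^sup>\<star>" for x y
    using that a b by (simp add: atoms_below_iff restricted_product_atom mult_mono)
  have factors: "\<exists>x y. z = x \<otimes> y \<and> x \<in> atoms_below a \<and> y \<in> atoms_below b \<and> x\<^sup>\<star> \<otimes> x = y \<otimes> y\<^sup>\<star>"
    if "z \<in> atoms_below (a \<otimes> b)" for z
  proof -
    have z: "z \<in> atoms S" "z \<preceq> a \<otimes> b"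
      using that by (simp_all add: atoms_below_iff)
    define d where "d = z\<^sup>\<star> \<otimes> z"
    have d: "d \<in> atoms S" "d \<in> E"
      using z by (simp_all add: d_def)
    define y where "y = b \<otimes> d"
    define r where "r = y \<otimes> y\<^sup>\<star>"
    define x where "x = a \<otimes> r"
    have C: "y \<in> carrier S" "r \<in> E" "x \<in> carrier S"
      using a b d by (simp_all add: y_def r_def x_def)
    have "z = a \<otimes> y"
      using below_restriction[of z "a \<otimes> b"] z a b d by (simp add: y_def d_def sg_assoc)
    moreover have "x \<otimes> y = a \<otimes> y"
      using a C(1) by (simp add: x_def r_def sg_assoc inverse_cancel)
    ultimately have xy: "z = x \<otimes> y" by simp
    have "y \<noteq> \<zero>" "x \<noteq> \<zero>"
      using xy atom_nonzero[OF z(1)] C by auto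
    have "y\<^sup>\<star> \<otimes> y \<preceq> d"
    proof -
      have "y\<^sup>\<star> \<otimes> y = (y\<^sup>\<star> \<otimes> b) \<otimes> d"
        using b C d by (simp add: y_def sg_assoc)
      also have "\<dots> = d \<otimes> (y\<^sup>\<star> \<otimes> b) \<otimes> d"
        using b d by (simp add: y_def inverse_mult sg_assoc)
      also have "\<dots> = d \<otimes> (y\<^sup>\<star> \<otimes> y)"
        using b C d by (simp add: y_def sg_assoc)
      finally show ?thesis
        using C d by (simp add: idempotent_below_iff)
    qed
    moreover have "y\<^sup>\<star> \<otimes> y \<noteq> \<zero>"
      using dom_eq_null C \<open>y \<noteq> \<zero>\<close> by blast
    ultimately have "y\<^sup>\<star> \<otimes> y = d"
      using below_atom[OF d(1)] C by simp
    then have y: "y \<in> atoms S"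
      using atom_if_dom_atom C(1) d by simp
    then have r: "r \<in> atoms S"
      by (simp add: r_def)
    have "x\<^sup>\<star> \<otimes> x \<preceq> r"
    proof -
      have "x\<^sup>\<star> \<otimes> x = r \<otimes> (x\<^sup>\<star> \<otimes> x)"
        using a C(2) by (simp add: x_def inverse_mult sg_assoc)
      then show ?thesis
        using C by (simp add: idempotent_below_iff)
    qed
    moreover have "x\<^sup>\<star> \<otimes> x \<noteq> \<zero>"
      using dom_eq_null C \<open>x \<noteq> \<zero>\<close> by blast
    ultimately have dx: "x\<^sup>\<star> \<otimes> x = r"
      using below_atom[OF r] C by simp
    then have "x \<in> atoms S"
      using atom_if_dom_atom C(3) r by simp
    moreover have "x \<preceq> a" "y \<preceq> b"
      using restriction_below a b C d by (simp_all add: x_def y_def)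
    ultimately show ?thesis
      using xy y dx by (auto simp: atoms_below_iff r_def)
  qed
  show ?thesis
    unfolding mult
  proof (intro equalityI subsetI)
    fix z
    assume "z \<in> atoms_below (a \<otimes> b)"
    then show "z \<in> {x \<otimes> y | x y. x \<in> atoms_below a \<and> y \<in> atoms_below b \<and> x\<^sup>\<star> \<otimes> x = y \<otimes> y\<^sup>\<star>}"
      unfolding mem_Collect_eq by (rule factors)
  next
    fix z
    assume "z \<in> {x \<otimes> y | x y. x \<in> atoms_below a \<and> y \<in> atoms_below b \<and> x\<^sup>\<star> \<otimes> x = y \<otimes> y\<^sup>\<star>}"
    then show "z \<in> atoms_below (a \<otimes> b)"
      unfolding mem_Collect_eq using product by (elim exE conjE) simp
  qed
qed

lemma atoms_below_null: "atoms_below \<zero> = {}"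
  using below_null atom_nonzero by (force simp: atoms_below_def)

text \<open>Restricting a join to the domain of an atom \<open>z\<close> below it writes \<open>z\<close> as the join of \<open>ad\<close> and
  \<open>bd\<close>.  These are zero or equal to \<open>z\<close>, and they are not both zero.\<close>

lemma atoms_below_join:
  assumes a: "a \<in> carrier S" and b: "b \<in> carrier S"
    and comp: "compatible S a b" and j: "is_sg_join S a b j"
  shows "atoms_below j = atoms_below a \<union> atoms_below b"
proof -
  have J: "j \<in> carrier S" "a \<preceq> j" "b \<preceq> j"
    using j is_join_iff[OF a b] by auto
  have "z \<preceq> a \<or> z \<preceq> b" if z: "z \<in> atoms S" "z \<preceq> j" for z
  proof -
    define d where "d = z\<^sup>\<star> \<otimes> z"
    have d: "d \<in> E"
      using z by (simp add: d_def)
    have "j \<otimes> d = z"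
      using below_restriction[of z j] z J by (simp add: d_def)
    then have "is_sg_join S (a \<otimes> d) (b \<otimes> d) z"
      using mult_join_right[OF a b _ comp j, of d] d by simp
    then have zz: "a \<otimes> d \<preceq> z" "b \<otimes> d \<preceq> z"
      and least: "\<And>u. u \<in> carrier S \<Longrightarrow> a \<otimes> d \<preceq> u \<Longrightarrow> b \<otimes> d \<preceq> u \<Longrightarrow> z \<preceq> u"
      using is_join_iff[of "a \<otimes> d" "b \<otimes> d" z] a b d by simp_all
    have "a \<otimes> d \<noteq> \<zero> \<or> b \<otimes> d \<noteq> \<zero>"
    proof (rule ccontr)
      assume "\<not> ?thesis"
      then have "z = \<zero>"
        using least[of "\<zero>"] below_null[of z] z by simp
      then show False
        using atom_nonzero z by simp
    qed
    then have "a \<otimes> d = z \<or> b \<otimes> d = z"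
      using below_atom[OF z(1)] zz a b d by auto
    then show ?thesis
      using restriction_below a b d by auto
  qed
  moreover have "z \<preceq> j" if "z \<in> atoms S" "z \<preceq> a \<or> z \<preceq> b" for z
    using that below_trans[of z a j] below_trans[of z b j] a b J by auto
  ultimately show ?thesis
    by (auto simp: atoms_below_def)
qed

text \<open>A nonzero element that is not an atom has a nonzero element strictly below it, and fewer elements
  lie below that one.\<close>

lemma exists_atom_below:
  assumes fin: "finite (carrier S)" and "a \<in> carrier S" "a \<noteq> \<zero>"
  shows "\<exists>x\<in>atoms S. x \<preceq> a"
  using assms(2,3)
proof (induction "card {y \<in> carrier S. y \<preceq> a}" arbitrary: a rule: less_induct)
  case less
  show ?case
  proof (cases "a \<in> atoms S")
    case True
    then show ?thesis
      using less.prems by (intro bexI[of _ a]) simp_all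
  next
    case False
    then obtain x where x: "x \<in> carrier S" "x \<preceq> a" "x \<noteq> \<zero>" "x \<noteq> a"
      using atomI less.prems by blast
    have "y \<preceq> a" if "y \<in> carrier S" "y \<preceq> x" for y
      using below_trans that x less.prems by blast
    moreover have "\<not> a \<preceq> x"
      using below_antisym x less.prems by blast
    ultimately have "{y \<in> carrier S. y \<preceq> x} \<subset> {y \<in> carrier S. y \<preceq> a}"
      using less.prems below_refl[of a] by blast
    then have "card {y \<in> carrier S. y \<preceq> x} < card {y \<in> carrier S. y \<preceq> a}"
      using fin by (intro psubset_card_mono) simp_all
    then obtain w where "w \<in> atoms S" "w \<preceq> x"
      using less.hyps x by blast
    then show ?thesis
      using below_trans[of w x a] x less.prems by auto
  qed
qed

lemma null_if_no_atoms_below: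
  "finite (carrier S) \<Longrightarrow> a \<in> carrier S \<Longrightarrow> atoms_below a = {} \<Longrightarrow> a = \<zero>"
  using exists_atom_below by (auto simp: atoms_below_def)

lemma atoms_below_inverse:
  assumes a: "a \<in> carrier S" and v: "v \<in> atoms_below (a\<^sup>\<star>)"
  shows "v\<^sup>\<star> \<in> atoms_below a"
  using v inverse_mono[of v "a\<^sup>\<star>"] a by (simp add: atoms_below_iff)

lemma atoms_below_atom:
  assumes "x \<in> atoms S"
  shows "atoms_below x = {x}"
  using assms below_atom[OF assms] atom_nonzero by (auto simp: atoms_below_def)

text \<open>The bisection is built up one atom at a time.  Let \<open>B = atoms_below j\<close>, and let \<open>x \<notin> B\<close> be an
  atom such that \<open>B\<close> together with \<open>x\<close> is still a local bisection.  No atom of \<open>B\<close> shares its domain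
  or its range with \<open>x\<close>, so the local bisections of \<open>x\<^sup>\<star>j\<close> and \<open>xj\<^sup>\<star>\<close> are empty products.  Both
  elements are therefore zero, which makes \<open>x\<close> and \<open>j\<close> compatible, and their join realises the
  enlarged bisection.\<close>

lemma exists_join_of_bisection:
  assumes fin: "finite (carrier S)" and "finite A" "local_bisection (\<A> S) A"
  shows "\<exists>j\<in>carrier S. atoms_below j = A"
  using assms(2,3)
proof (induction A rule: finite_induct)
  case empty
  then show ?case
    using atoms_below_null by (intro bexI[of _ "\<zero>"]) simp_all
next
  case (insert x B)
  have sub: "insert x B \<subseteq> atoms S"
    and inj: "\<And>a b. a \<in> insert x B \<Longrightarrow> b \<in> insert x B \<Longrightarrow> a\<^sup>\<star> \<otimes> a = b\<^sup>\<star> \<otimes> b \<Longrightarrow> a = b"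
      "\<And>a b. a \<in> insert x B \<Longrightarrow> b \<in> insert x B \<Longrightarrow> a \<otimes> a\<^sup>\<star> = b \<otimes> b\<^sup>\<star> \<Longrightarrow> a = b"
    using insert.prems unfolding atom_bisection_iff by blast+
  have x: "x \<in> atoms S"
    using sub by simp
  have dom: "x\<^sup>\<star> \<otimes> x \<noteq> v\<^sup>\<star> \<otimes> v" and ran: "x \<otimes> x\<^sup>\<star> \<noteq> v \<otimes> v\<^sup>\<star>" if "v \<in> B" for v
    using inj[of x v] that insert.hyps(2) by auto
  have "local_bisection (\<A> S) B"
    using insert.prems unfolding atom_bisection_iff by simp
  then obtain j where j: "j \<in> carrier S" "atoms_below j = B"
    using insert.IH by blast
  have atoms: "atoms_below a \<subseteq> atoms S" for a
    by (auto simp: atoms_below_def)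
  have "atoms_below (x\<^sup>\<star> \<otimes> j) = {x\<^sup>\<star>} \<otimes>\<^bsub>\<K> (\<A> S)\<^esub> B"
    using atoms_below_mult[of "x\<^sup>\<star>" j] atoms_below_atom[of "x\<^sup>\<star>"] x j by simp
  also have "\<dots> = {}"
    using atom_bisection_mult[of "{x\<^sup>\<star>}" B] x atoms[of j] j ran by auto
  finally have "x\<^sup>\<star> \<otimes> j = \<zero>"
    using null_if_no_atoms_below[OF fin] x j by simp
  have "atoms_below (x \<otimes> j\<^sup>\<star>) = {x} \<otimes>\<^bsub>\<K> (\<A> S)\<^esub> atoms_below (j\<^sup>\<star>)"
    using atoms_below_mult[of x "j\<^sup>\<star>"] atoms_below_atom[of x] x j by simp
  also have "\<dots> = {}"
  proof -
    have "x\<^sup>\<star> \<otimes> x \<noteq> v \<otimes> v\<^sup>\<star>" if "v \<in> atoms_below (j\<^sup>\<star>)" for v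
      using dom[of "v\<^sup>\<star>"] atoms_below_inverse[OF j(1) that] that j by (simp add: atoms_below_iff)
    then show ?thesis
      using atom_bisection_mult[of "{x}" "atoms_below (j\<^sup>\<star>)"] x atoms[of "j\<^sup>\<star>"] by auto
  qed
  finally have "x \<otimes> j\<^sup>\<star> = \<zero>"
    using null_if_no_atoms_below[OF fin] x j by simp
  have comp: "compatible S x j"
    unfolding compatible_def \<open>x\<^sup>\<star> \<otimes> j = \<zero>\<close> \<open>x \<otimes> j\<^sup>\<star> = \<zero>\<close> by simp
  then obtain k where k: "is_sg_join S x j k"
    using compatible_join_exists x j atom_closed by blast
  then have "atoms_below k = insert x B"
    using atoms_below_join[OF _ j(1) comp k] atoms_below_atom[OF x] x j by simp
  then show ?case
    using k is_join_iff[of x j k] x j by auto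
qed

end

context boolean_inverse_semigroup
begin

text \<open>The complement of \<open>e\<close> in the Boolean algebra of idempotents below \<open>f\<close> is an idempotent \<open>g\<close> whose join
  with \<open>e\<close> is \<open>f\<close> when only idempotents below \<open>f\<close> compete.  It is also a join in the whole semigroup:
  \<open>e\<close> and \<open>g\<close> are compatible, so they have a join \<open>j\<close> there, and \<open>j \<le> f\<close> is itself an idempotent below
  \<open>f\<close>.\<close>

lemma relative_complement:
  assumes e: "e \<in> E" and f: "f \<in> E" and ef: "e \<preceq> f"
  shows "\<exists>g\<in>E. g \<preceq> f \<and> e \<otimes> g = \<zero> \<and> is_sg_join S e g f"
proof -
  let ?L = "principal_ideal (idempotent_order S) f"
  have carrier: "carrier ?L = {y \<in> E. y \<preceq> f}"
    by (simp add: principal_ideal_def idempotent_order_def)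
  have le: "le ?L = le (natural_order S)"
    by (simp add: principal_ideal_def idempotent_order_def)
  interpret B: unital_boolean_algebra ?L
    using generalized_boolean_algebra.principal_ideal_boolean[OF idempotents_boolean] f
    by (simp add: idempotent_order_def)
  obtain g where g: "g \<in> E" "g \<preceq> f" and meet: "e \<sqinter>\<^bsub>?L\<^esub> g = \<bottom>\<^bsub>?L\<^esub>" and join: "e \<squnion>\<^bsub>?L\<^esub> g = \<top>\<^bsub>?L\<^esub>"
    using B.complement_exists[of e] e ef unfolding carrier by blast
  have eg: "e \<otimes> g \<in> E" "e \<otimes> g \<preceq> e" "e \<otimes> g \<preceq> g"
    using e g idempotent_product restriction_below corestriction_below by simp_all
  have memb: "e \<in> carrier ?L" "g \<in> carrier ?L" "e \<otimes> g \<in> carrier ?L" "\<zero> \<in> carrier ?L" "f \<in> carrier ?L"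
    using e f g ef eg below_trans[of "e \<otimes> g" e f] unfolding carrier by simp_all
  have "e \<otimes> g \<sqsubseteq>\<^bsub>?L\<^esub> e \<sqinter>\<^bsub>?L\<^esub> g"
    using eg memb by (intro B.meet_le) (simp_all add: le)
  moreover have "\<bottom>\<^bsub>?L\<^esub> \<sqsubseteq>\<^bsub>?L\<^esub> \<zero>"
    using memb by (intro B.bottom_lower)
  ultimately have "e \<otimes> g \<sqsubseteq>\<^bsub>?L\<^esub> \<zero>"
    unfolding meet by (rule B.le_trans) (use memb B.bottom_closed in simp_all)
  then have zero: "e \<otimes> g = \<zero>"
    using below_null e g unfolding le by simp
  then have "compatible S e g"
    using e g by (simp add: compatible_def)
  then obtain j where j: "is_sg_join S e g j"
    using compatible_join_exists e g idempotent_closed by blast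
  then have J: "j \<in> carrier S" "e \<preceq> j" "g \<preceq> j" "j \<preceq> f"
    using is_join_iff[of e g j] e f g ef by simp_all
  then have jL: "j \<in> carrier ?L"
    unfolding carrier using below_idempotent f by blast
  have "f \<sqsubseteq>\<^bsub>?L\<^esub> \<top>\<^bsub>?L\<^esub>"
    using memb by (intro B.top_higher)
  moreover have "\<top>\<^bsub>?L\<^esub> \<sqsubseteq>\<^bsub>?L\<^esub> j"
    unfolding join[symmetric] using J memb jL by (intro B.join_le) (simp_all add: le)
  ultimately have "f \<sqsubseteq>\<^bsub>?L\<^esub> j"
    by (rule B.le_trans) (use memb jL B.top_closed in simp_all)
  then have "j = f"
    using below_antisym[of j f] J f unfolding le by simp
  then show ?thesis
    using g zero j by blast
qed

text \<open>Induction on the number of atoms below \<open>a\<close>.  Choose an atom \<open>x \<le> a\<close> with domain \<open>d\<close>, and let \<open>g\<close> be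
  the complement of \<open>d\<close> below \<open>a\<^sup>\<star>a\<close>.  By distributivity \<open>a = a(a\<^sup>\<star>a)\<close> is the join of \<open>ad = x\<close> and
  \<open>ag\<close>.  The atom \<open>x\<close> is not below \<open>ag\<close>, so induction applies to \<open>ag\<close>; both \<open>x\<close> and \<open>ag\<close> are then below
  \<open>b\<close>, and so is their join \<open>a\<close>.\<close>

lemma below_if_atoms_below_subset:
  assumes fin: "finite (carrier S)" and b: "b \<in> carrier S"
    and "a \<in> carrier S" "atoms_below a \<subseteq> atoms_below b"
  shows "a \<preceq> b"
  using assms(3,4)
proof (induction "card (atoms_below a)" arbitrary: a rule: less_induct)
  case less
  note a = less.prems(1)
  show ?case
  proof (cases "a = \<zero>")
    case True
    then show ?thesis using b by simp
  next
    case False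
    then obtain x where x: "x \<in> atoms S" "x \<preceq> a"
      using exists_atom_below[OF fin a] by blast
    define d where "d = x\<^sup>\<star> \<otimes> x"
    have d: "d \<in> E" "d \<preceq> a\<^sup>\<star> \<otimes> a"
      using x a dom_mono by (simp_all add: d_def)
    obtain g where g: "g \<in> E" "g \<preceq> a\<^sup>\<star> \<otimes> a" "d \<otimes> g = \<zero>" "is_sg_join S d g (a\<^sup>\<star> \<otimes> a)"
      using relative_complement[OF d(1) dom_idempotent[OF a] d(2)] by blast
    have "compatible S d g"
      using d g by (simp add: compatible_def)
    then have "is_sg_join S (a \<otimes> d) (a \<otimes> g) (a \<otimes> (a\<^sup>\<star> \<otimes> a))"
      using mult_join_left[OF _ _ a _ g(4)] d g by simp
    moreover have "a \<otimes> d = x"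
      using below_restriction[of x a] x a by (simp add: d_def)
    ultimately have join: "is_sg_join S x (a \<otimes> g) a"
      using a by (simp add: inverse_cancel)
    have ag: "a \<otimes> g \<in> carrier S" "a \<otimes> g \<preceq> a"
      using a g restriction_below by simp_all
    have sub: "atoms_below (a \<otimes> g) \<subseteq> atoms_below a"
      using below_trans[OF _ ag(1) a _ ag(2)] by (auto simp: atoms_below_def)
    have "x \<notin> atoms_below (a \<otimes> g)"
    proof
      assume "x \<in> atoms_below (a \<otimes> g)"
      then have "d \<preceq> g"
        using dom_mono[of x "a \<otimes> g"] dom_restriction[OF a g(1,2)] x ag
        by (simp add: atoms_below_iff d_def)
      then have "d = g \<otimes> d"
        using idempotent_below_iff d g by simp
      then have "d = \<zero>"
        using idempotent_commute[of g d] d g by simp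
      then show False
        using dom_atom[OF x(1)] atom_nonzero by (simp add: d_def)
    qed
    then have "atoms_below (a \<otimes> g) \<subset> atoms_below a"
      using sub x by (auto simp: atoms_below_iff)
    moreover have "finite (atoms_below a)"
      by (rule finite_subset[OF _ fin]) (auto simp: atoms_below_def)
    ultimately have "card (atoms_below (a \<otimes> g)) < card (atoms_below a)"
      by (intro psubset_card_mono)
    then have "a \<otimes> g \<preceq> b"
      using less.hyps ag(1) sub less.prems(2) by blast
    moreover have "x \<preceq> b"
      using x less.prems(2) by (auto simp: atoms_below_iff)
    ultimately show ?thesis
      using join is_join_iff[of x "a \<otimes> g" a] x ag b by simp
  qed
qed

theorem atoms_below_iso:
  assumes fin: "finite (carrier S)"
  shows "atoms_below \<in> iso S (\<K> (\<A> S))"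
proof -
  interpret G: groupoid "\<A> S"
    by (rule atoms_groupoid)
  have "atoms_below ` carrier S = carrier (\<K> (\<A> S))"
  proof (intro equalityI subsetI)
    fix A
    assume "A \<in> carrier (\<K> (\<A> S))"
    then have A: "local_bisection (\<A> S) A"
      by (simp add: G.bisection_carrier)
    then have "A \<subseteq> carrier S"
      unfolding atom_bisection_iff using atom_closed by blast
    then have "finite A"
      using fin finite_subset by blast
    then show "A \<in> atoms_below ` carrier S"
      using exists_join_of_bisection[OF fin _ A] by blast
  qed (auto simp: G.bisection_carrier atoms_below_bisection)
  moreover have "inj_on atoms_below (carrier S)"
  proof (rule inj_onI)
    fix a b
    assume ab: "a \<in> carrier S" "b \<in> carrier S" "atoms_below a = atoms_below b"
    then show "a = b"
      by (intro below_antisym below_if_atoms_below_subset[OF fin]) simp_all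
  qed
  moreover have "atoms_below \<in> hom S (\<K> (\<A> S))"
    by (simp add: hom_def G.bisection_carrier atoms_below_bisection atoms_below_mult)
  ultimately show ?thesis
    by (simp add: iso_iff)
qed

lemma atoms_nonempty:
  assumes fin: "finite (carrier S)"
  shows "atoms S \<noteq> {}"
proof -
  obtain a where "a \<in> carrier S" "a \<noteq> \<zero>"
    using not_zero_semigroup null_closed by blast
  then show ?thesis
    using exists_atom_below[OF fin] by blast
qed

end

theorem theorem4p5:
  fixes S :: "('a, 'b) monoid_scheme"
  assumes "boolean_inverse_monoid S"
    and "finite (carrier S)"
  shows "groupoid (\<A> S) \<and> boolean_inverse_monoid (\<K> (\<A> S)) \<and> S \<cong> \<K> (\<A> S)"
proof -
  interpret boolean_inverse_monoid S
    by (rule assms)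
  interpret G: groupoid "\<A> S"
    by (rule atoms_groupoid)
  have "boolean_inverse_monoid (\<K> (\<A> S))"
    using atoms_nonempty[OF assms(2)] by (intro G.bisections_boolean_inverse_monoid) (simp add: atom_carrier)
  then show ?thesis
    using G.groupoid_axioms is_isoI[OF atoms_below_iso[OF assms(2)]] by blast
qed

end
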